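(* Let $p>3$ be a prime. Then $$\sum_{k=0}^{p-1}\frac{\binom{2k}k\binom{3k}k}{54^k}\equiv\begin{cases} 2A-\dfrac p{2A}\pmod{p^2} &\text{if } p\equiv 1\pmod 3,\ p=A^2+3B^2 \text{ with } A,B\in\mathbb{Z} \text{ and } A\equiv 1\pmod 3,\\[2mm] 0\pmod{p^2}&\text{if } p\equiv 2\pmod 3.\end{cases}$$
   Context: Congruences modulo $p^2$ are between rational numbers whose denominators are not divisible by $p$. *)

theory Defs
  imports Complex_Main "HOL-Number_Theory.Number_Theory"
begin

text \<open>\<^const>\<open>quotient_of\<close> returns the reduced fraction, so the condition concerns the
  denominator in lowest terms.\<close>

definition p_integral :: "nat \<Rightarrow> rat \<Rightarrow> bool" where
  "p_integral p x \<longleftrightarrow> \<not> int p dvd snd (quotient_of x)"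

text \<open>Congruence modulo \<open>p ^ n\<close> in the ring of rational numbers whose denominators are not
  divisible by \<open>p\<close>. Both sides are required to lie in that ring.\<close>

definition rat_cong :: "nat \<Rightarrow> nat \<Rightarrow> rat \<Rightarrow> rat \<Rightarrow> bool" where
  "rat_cong p n x y \<longleftrightarrow>
     p_integral p x \<and> p_integral p y \<and>
     (\<exists>z. p_integral p z \<and> x - y = of_nat (p ^ n) * z)"

end

theory Submission
  imports Defs "HOL-Computational_Algebra.Polynomial"
begin

text \<open>
  Since \<open>(2k choose k) (3k choose k) / 27^k = (1/3)_k (2/3)_k / k!^2\<close>, the sum is a truncated
  hypergeometric series at \<open>1/2\<close>. Write \<open>P_n(0) = \<Sum>k. (n choose k) (n + k choose k) (-1/2)^k\<close> for
  the Legendre polynomial at the origin. Since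
  \<open>(n choose k) (n + k choose k) k!^2 = \<Prod>i<k. n (n + 1) - i (i + 1)\<close>, both the sum and the
  \<open>P_n(0)\<close> with \<open>n < p\<close> are values of one and the same polynomial \<open>\<Phi>\<close> with \<open>p\<close>-integral
  coefficients: the sum is \<open>\<Phi>(-2/9)\<close> and \<open>P_n(0) = \<Phi>(n (n + 1))\<close>. Let \<open>n = p div 3\<close>. The three points
  \<open>-2/9\<close>, \<open>n (n + 1)\<close> and \<open>l (l + 1)\<close> with \<open>l = p - 1 - n\<close> agree modulo \<open>p\<close>, and on a residue
  class modulo \<open>p\<close> the polynomial \<open>\<Phi>\<close> is affine modulo \<open>p^2\<close>. Linear interpolation yields
  \<open>3 \<Phi>(-2/9) \<equiv> 2 P_n(0) + P_l(0)\<close> modulo \<open>p^2\<close> (\<open>truncated_sum_interpolation\<close>). The Legendre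
  polynomial of odd degree vanishes at the origin, and that of degree \<open>2 m\<close> has the value
  \<open>(-1/2 gchoose m)\<close> there (\<open>legendre_at_zero\<close>). If \<open>p \<equiv> 2\<close> modulo \<open>3\<close>, both \<open>n\<close> and \<open>l\<close> are odd,
  and the sum vanishes modulo \<open>p^2\<close>.

  Let \<open>p = 3 q + 1\<close>. Then \<open>n = q\<close> and \<open>l = 2 q\<close>, so three times the sum is congruent to
  \<open>2 (-1/2 gchoose q/2) + (-1/2 gchoose q)\<close>. Modulo \<open>p^2\<close> this is \<open>-3 J\<close> for a Jacobi sum \<open>J\<close> of a cubic and the
  quadratic character, where the characters take values in the integers modulo \<open>p^2\<close>: powers of
  the Teichmueller lift \<open>g^p\<close> of a primitive root \<open>g\<close> represent the cubic character, and the
  quadratic character of \<open>x\<close> is \<open>x^(p (p - 1) / 2)\<close>. Expanding this power of \<open>g^(p i) + 1\<close> by the binomial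
  theorem and summing over \<open>i\<close> leaves only the binomial coefficients \<open>(p (p - 1) / 2 choose j)\<close> with
  \<open>j \<equiv> q\<close> modulo \<open>p - 1\<close>. Modulo \<open>p^2\<close> those add up, by a Vandermonde convolution, to two binomial
  coefficients (\<open>sum_choose_arithmetic_progression\<close>), which are congruent to \<open>(-3/2 gchoose q)\<close> and
  \<open>(-3/2 gchoose q/2)\<close>; this gives \<open>J_cong_half_binomials\<close>.

  On the other hand \<open>J = N 0 + \<zeta> N 1 + \<zeta>^2 N 2\<close>, where \<open>\<zeta>\<close> is a primitive cube root of unity modulo
  \<open>p^2\<close> and the integers \<open>N r\<close> are sums of Legendre symbols over the three cubic classes. The
  autocorrelation of \<open>x \<mapsto> Legendre (x + 1) p\<close> on the multiplicative group shows that the norm form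
  of the \<open>N r\<close> is \<open>p\<close> (\<open>norm_N\<close>). With the parities of the \<open>N r\<close> it follows that
  \<open>p = A^2 + 3 B^2\<close> with \<open>A \<equiv> 1\<close> modulo \<open>3\<close> and \<open>2 A = - (2 N 0 - N 1 - N 2)\<close>
  (\<open>quadratic_form_N\<close>), and such an \<open>A\<close> is unique. Hence \<open>-J\<close> and its conjugate \<open>-J'\<close> have the sum
  \<open>2 A\<close> and the product \<open>p\<close> modulo \<open>p^2\<close>. As \<open>J\<close> is a unit modulo \<open>p\<close>, this pins it down:
  \<open>-J \<equiv> 2 A - p / (2 A)\<close> modulo \<open>p^2\<close> (\<open>unit_root_expansion\<close>).
\<close>

section \<open>Congruences between rational numbers modulo a prime power\<close>

text \<open>
  Any representation as a fraction with a denominator prime to \<open>p\<close> is as good as the reduced one,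
  because the reduced denominator divides every other; closure under the ring operations is then a
  matter of multiplying denominators.
\<close>

lemma p_integral_iff:
  "p_integral p x \<longleftrightarrow> (\<exists>a b. \<not> int p dvd b \<and> x = of_int a / of_int b)"
proof
  assume "p_integral p x"
  moreover obtain a b where q: "quotient_of x = (a, b)" by force
  ultimately show "\<exists>a b. \<not> int p dvd b \<and> x = of_int a / of_int b"
    using quotient_of_div[OF q] by (auto simp: p_integral_def)
next
  assume "\<exists>a b. \<not> int p dvd b \<and> x = of_int a / of_int b"
  then obtain a b where b: "\<not> int p dvd b" and x: "x = of_int a / of_int b" by blast
  from b have b0: "b \<noteq> 0" by auto
  obtain c d where q: "quotient_of x = (c, d)" by force
  have d0: "d > 0" and xd: "x = of_int c / of_int d" and cop: "coprime c d"
    using quotient_of_denom_pos[OF q] quotient_of_div[OF q] quotient_of_coprime[OF q] by auto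
  have "of_int (a * d) = (of_int (c * b) :: rat)"
    using x xd b0 d0 by (simp add: field_simps)
  hence "a * d = c * b" by (simp only: of_int_eq_iff)
  hence "d dvd b" using cop by (metis coprime_commute coprime_dvd_mult_right_iff dvd_triv_right)
  thus "p_integral p x" using b q by (auto simp: p_integral_def)
qed

locale prime_modulus =
  fixes p :: nat
  assumes prime: "prime p"
begin

lemma p_integral_of_int [simp]: "p_integral p (of_int a)"
  using prime by (auto simp: p_integral_def dest: prime_gt_1_nat)

lemma p_integral_of_nat [simp]: "p_integral p (of_nat a)"
  using p_integral_of_int[of "int a"] by simp

lemma p_integral_numeral [simp]:
  "p_integral p 0" "p_integral p 1" "p_integral p (numeral w)"
  using p_integral_of_nat[of 0] p_integral_of_nat[of 1] p_integral_of_nat[of "numeral w"]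
  by simp_all

lemma p_integral_add [intro]: "p_integral p x \<Longrightarrow> p_integral p y \<Longrightarrow> p_integral p (x + y)"
  and p_integral_mult [intro]: "p_integral p x \<Longrightarrow> p_integral p y \<Longrightarrow> p_integral p (x * y)"
proof -
  assume "p_integral p x" "p_integral p y"
  then obtain a b c d where *: "\<not> int p dvd b" "x = of_int a / of_int b"
    "\<not> int p dvd d" "y = of_int c / of_int d" unfolding p_integral_iff by metis
  have bd: "\<not> int p dvd b * d" using * prime by (simp add: prime_dvd_mult_iff)
  have "b \<noteq> 0" "d \<noteq> 0" using * by auto
  hence "x + y = of_int (a * d + c * b) / of_int (b * d)"
    using * by (simp add: field_simps)
  thus "p_integral p (x + y)" using bd unfolding p_integral_iff by blast
  have "x * y = of_int (a * c) / of_int (b * d)" using * by simp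
  thus "p_integral p (x * y)" using bd unfolding p_integral_iff by blast
qed

lemma p_integral_minus [intro]: "p_integral p x \<Longrightarrow> p_integral p (- x)"
  using p_integral_mult[of "of_int (-1)" x] p_integral_of_int[of "-1"] by simp

lemma p_integral_diff [intro]: "p_integral p x \<Longrightarrow> p_integral p y \<Longrightarrow> p_integral p (x - y)"
  using p_integral_add[of x "- y"] by auto

lemma p_integral_inverse_int: "\<not> int p dvd b \<Longrightarrow> p_integral p (1 / of_int b)"
  unfolding p_integral_iff by (metis of_int_1)

lemma p_integral_divide_int [intro]:
  "p_integral p x \<Longrightarrow> \<not> int p dvd b \<Longrightarrow> p_integral p (x / of_int b)"
  using p_integral_mult[OF _ p_integral_inverse_int, of x b] by simp

lemma p_integral_divide_nat:
  "p_integral p x \<Longrightarrow> \<not> p dvd b \<Longrightarrow> p_integral p (x / of_nat b)"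
  using p_integral_divide_int[of x "int b"] by simp

lemma p_integral_power [intro]: "p_integral p x \<Longrightarrow> p_integral p (x ^ n)"
  by (induction n) auto

lemma rat_congI:
  "p_integral p y \<Longrightarrow> p_integral p z \<Longrightarrow> x = y + of_nat (p ^ n) * z \<Longrightarrow> rat_cong p n x y"
  unfolding rat_cong_def by (metis add_diff_cancel_left' p_integral_add p_integral_mult p_integral_of_nat)

lemma rat_congE:
  assumes "rat_cong p n x y"
  obtains z where "p_integral p x" "p_integral p y" "p_integral p z" "x = y + of_nat (p ^ n) * z"
  using assms unfolding rat_cong_def by (metis add_diff_cancel_left' diff_add_cancel add.commute)

lemma rat_cong_integralD: "rat_cong p n x y \<Longrightarrow> p_integral p x" "rat_cong p n x y \<Longrightarrow> p_integral p y"
  by (simp_all add: rat_cong_def)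

lemma rat_cong_refl [intro]: "p_integral p x \<Longrightarrow> rat_cong p n x x"
  by (rule rat_congI[of _ 0]) auto

lemma rat_cong_sym: "rat_cong p n x y \<Longrightarrow> rat_cong p n y x"
proof (erule rat_congE)
  fix z assume "p_integral p x" "p_integral p y" "p_integral p z" "x = y + of_nat (p ^ n) * z"
  thus ?thesis by (intro rat_congI[of _ "-z"]) auto
qed

lemma rat_cong_add:
  assumes "rat_cong p n a b" "rat_cong p n c d" shows "rat_cong p n (a + c) (b + d)"
proof -
  from assms(1) obtain z where 1: "p_integral p b" "p_integral p z" "a = b + of_nat (p ^ n) * z"
    by (rule rat_congE)
  from assms(2) obtain w where 2: "p_integral p d" "p_integral p w" "c = d + of_nat (p ^ n) * w"
    by (rule rat_congE)
  show ?thesis by (rule rat_congI[of _ "z + w"]) (use 1 2 in \<open>auto simp: algebra_simps\<close>)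
qed

lemma rat_cong_mult:
  assumes "rat_cong p n a b" "rat_cong p n c d" shows "rat_cong p n (a * c) (b * d)"
proof -
  from assms(1) obtain z where 1: "p_integral p a" "p_integral p b" "p_integral p z"
    "a = b + of_nat (p ^ n) * z"  by (rule rat_congE)
  from assms(2) obtain w where 2: "p_integral p d" "p_integral p w" "c = d + of_nat (p ^ n) * w"
    by (rule rat_congE)
  have "a * c = b * d + of_nat (p ^ n) * (z * d + a * w)"
    unfolding 1(4) 2(3) by (simp add: algebra_simps)
  thus ?thesis using 1 2 by (intro rat_congI[of _ "z * d + a * w"]) auto
qed

lemma rat_cong_trans [trans]:
  assumes "rat_cong p n a b" "rat_cong p n b c" shows "rat_cong p n a c"
proof -
  from assms(1) obtain z where 1: "p_integral p z" "a = b + of_nat (p ^ n) * z"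
    by (rule rat_congE)
  from assms(2) obtain w where 2: "p_integral p c" "p_integral p w" "b = c + of_nat (p ^ n) * w"
    by (rule rat_congE)
  show ?thesis by (rule rat_congI[of _ "z + w"]) (use 1 2 in \<open>auto simp: algebra_simps\<close>)
qed

lemma rat_cong_scale: "p_integral p c \<Longrightarrow> rat_cong p n a b \<Longrightarrow> rat_cong p n (c * a) (c * b)"
  by (rule rat_cong_mult) auto

lemma rat_cong_diff:
  "rat_cong p n a b \<Longrightarrow> rat_cong p n c d \<Longrightarrow> rat_cong p n (a - c) (b - d)"
  using rat_cong_add[of n a b "-1 * c" "-1 * d"] rat_cong_scale[of "of_int (-1)" n c d]
    p_integral_of_int[of "-1"] by simp

lemma rat_cong_prod:
  "(\<And>i. i \<in> A \<Longrightarrow> rat_cong p n (f i) (g i)) \<Longrightarrow> rat_cong p n (prod f A) (prod g A)"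
  by (induction A rule: infinite_finite_induct) (auto intro: rat_cong_mult)

lemma rat_cong_of_int:
  assumes "[a = b] (mod int (p ^ n))" shows "rat_cong p n (of_int a) (of_int b)"
proof -
  obtain k where "a = b + int (p ^ n) * k"
    using assms by (metis cong_iff_lin cong_sym mult.commute)
  hence "(of_int a :: rat) = of_int b + of_nat (p ^ n) * of_int k" by simp
  thus ?thesis by (intro rat_congI[of _ "of_int k"]) auto
qed

text \<open>
  The way back from rational to integer congruences: a denominator prime to \<open>p\<close> can be cancelled.
\<close>

lemma cong_of_rat_cong:
  assumes "rat_cong p n (of_int a) (of_int b)" shows "[a = b] (mod int (p ^ n))"
proof -
  from assms obtain z where z: "p_integral p z" "of_int a = of_int b + of_nat (p ^ n) * z"
    by (rule rat_congE)
  then obtain c d where cd: "\<not> int p dvd d" "z = of_int c / of_int d" unfolding p_integral_iff by auto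
  hence "d \<noteq> 0" by auto
  have "of_int ((a - b) * d) = (of_int (int (p ^ n) * c) :: rat)"
    using z(2) cd(2) \<open>d \<noteq> 0\<close> by (simp add: field_simps)
  hence "(a - b) * d = int (p ^ n) * c" by (simp only: of_int_eq_iff)
  hence "int (p ^ n) dvd (a - b) * d" by simp
  moreover have "coprime (int (p ^ n)) d"
    using cd(1) prime by (simp add: prime_imp_coprime coprime_power_left_iff)
  ultimately have "int (p ^ n) dvd a - b" by (simp add: coprime_dvd_mult_left_iff)
  thus ?thesis by (simp add: cong_iff_dvd_diff)
qed

lemma rat_cong_mono: "rat_cong p 2 x y \<Longrightarrow> rat_cong p 1 x y"
  by (erule rat_congE, rule_tac z = "of_nat p * z" in rat_congI) (auto simp: power2_eq_square)

text \<open>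
  In a multiple of \<open>p\<close> only the residue modulo \<open>p\<close> of the cofactor counts. This is what makes the
  correction terms of first order computable.
\<close>

lemma rat_cong_p_mult:
  assumes "rat_cong p 1 x y" shows "rat_cong p 2 (of_nat p * x) (of_nat p * y)"
proof -
  from assms obtain z where "p_integral p y" "p_integral p z" "x = y + of_nat (p ^ 1) * z"
    by (rule rat_congE)
  thus ?thesis by (intro rat_congI[of _ z]) (auto simp: power2_eq_square algebra_simps)
qed

lemma rat_cong_cancel_int:
  assumes "\<not> int p dvd c" and "rat_cong p n (of_int c * x) (of_int c * y)"
  shows "rat_cong p n x y"
proof -
  from assms(1) have c: "c \<noteq> 0" by auto
  have "rat_cong p n (1 / of_int c * (of_int c * x)) (1 / of_int c * (of_int c * y))"
    by (rule rat_cong_scale[OF p_integral_inverse_int[OF assms(1)] assms(2)])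
  thus ?thesis using c by simp
qed

lemma not_dvd_fact: "k < p \<Longrightarrow> \<not> p dvd fact k"
  using prime by (simp add: prime_dvd_fact_iff)

lemma p_integral_divide_fact: "k < p \<Longrightarrow> p_integral p x \<Longrightarrow> p_integral p (x / fact k)"
  using p_integral_divide_nat[of x "fact k"] not_dvd_fact[of k] by simp

text \<open>
  As \<open>k!\<close> is a unit modulo \<open>p\<close> for \<open>k < p\<close>, the binomial coefficient is a polynomial in its upper
  argument with \<open>p\<close>-integral coefficients.
\<close>

lemma rat_cong_gbinomial:
  assumes "k < p" "rat_cong p n x y" shows "rat_cong p n (x gchoose k) (y gchoose k)"
proof (rule rat_cong_cancel_int[of "fact k"])
  show "\<not> int p dvd fact k"
    using not_dvd_fact[OF assms(1)] by (metis of_nat_dvd_iff of_nat_fact)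
  have "rat_cong p n (\<Prod>i = 0..<k. x - of_nat i) (\<Prod>i = 0..<k. y - of_nat i)"
    using assms by (intro rat_cong_prod rat_cong_diff rat_cong_refl) auto
  thus "rat_cong p n (of_int (fact k) * (x gchoose k)) (of_int (fact k) * (y gchoose k))"
    by (simp add: gbinomial_mult_fact)
qed


end

section \<open>The Legendre polynomial at the origin\<close>

lemma coeff_binomial_power: "coeff ([:1, a:] ^ n) k = of_nat (n choose k) * (a :: rat) ^ k"
proof (cases "k \<le> n")
  case False
  have "degree ([:1, a:] ^ n) \<le> degree [:1, a:] * n" by (rule degree_power_le)
  also have "\<dots> < k" using False by (auto simp: not_le)
  finally show ?thesis using False by (simp add: coeff_eq_0 binomial_eq_0)
qed (simp add: coeff_linear_poly_power)

text \<open>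
  The factor \<open>(n + k choose n)\<close> is the coefficient of \<open>x^n\<close> in \<open>(1 + x)^(n + k)\<close>, so the sum is the
  coefficient of \<open>x^n\<close> in \<open>(1 + x)^n (1 - (1 + x) / 2)^n = (1 + x)^n (1 - x)^n / 2^n\<close>.
\<close>

lemma legendre_at_zero_coeff:
  "(\<Sum>k\<le>n. of_nat (n choose k) * of_nat ((n + k) choose k) * (- 1 / 2 :: rat) ^ k) =
     coeff ([:1, 0, -1:] ^ n) n / 2 ^ n"
proof -
  have "(\<Sum>k\<le>n. of_nat (n choose k) * of_nat ((n + k) choose k) * (- 1 / 2 :: rat) ^ k) =
      (\<Sum>k\<le>n. coeff (smult (of_nat (n choose k) * (- 1 / 2) ^ k) ([:1, 1:] ^ (n + k))) n)"
    by (rule sum.cong) (simp_all add: coeff_binomial_power binomial_symmetric[of n "n + _"])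
  also have "\<dots> = coeff (\<Sum>k\<le>n. smult (of_nat (n choose k) * (- 1 / 2) ^ k) ([:1, 1:] ^ (n + k))) n"
    by (simp add: coeff_sum)
  also have "(\<Sum>k\<le>n. smult (of_nat (n choose k) * (- 1 / 2 :: rat) ^ k) ([:1, 1:] ^ (n + k))) =
     [:1, 1:] ^ n * (\<Sum>k\<le>n. of_nat (n choose k) * [:- 1 / 2, - 1 / 2:] ^ k * 1 ^ (n - k))"
    unfolding sum_distrib_left
  proof (rule sum.cong[OF refl])
    fix k
    have "[:- 1 / 2, - 1 / 2 :: rat:] = smult (- 1 / 2) [:1, 1:]" by simp
    hence "[:- 1 / 2, - 1 / 2 :: rat:] ^ k = smult ((- 1 / 2) ^ k) ([:1, 1:] ^ k)"
      by (simp only: smult_power)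
    thus "smult (of_nat (n choose k) * (- 1 / 2 :: rat) ^ k) ([:1, 1:] ^ (n + k)) =
       [:1, 1:] ^ n * (of_nat (n choose k) * [:- 1 / 2, - 1 / 2:] ^ k * 1 ^ (n - k))"
      by (simp add: power_add of_nat_poly mult_ac)
  qed
  also have "(\<Sum>k\<le>n. of_nat (n choose k) * [:- 1 / 2, - 1 / 2 :: rat:] ^ k * 1 ^ (n - k)) =
      ([:- 1 / 2, - 1 / 2:] + 1) ^ n"
    by (rule binomial_ring[symmetric])
  also have "[:- 1 / 2, - 1 / 2 :: rat:] + 1 = smult (1 / 2) [:1, -1:]"
    by (simp add: one_pCons)
  also have "[:1, 1:] ^ n * (smult (1 / 2 :: rat) [:1, -1:]) ^ n = smult ((1 / 2) ^ n) ([:1, 0, -1:] ^ n)"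
    by (simp add: smult_power[symmetric] power_mult_distrib[symmetric] one_pCons del: smult_pCons)
  also have "coeff \<dots> n = coeff ([:1, 0, -1:] ^ n) n / 2 ^ n"
    by (simp add: power_one_over field_simps)
  finally show ?thesis .
qed

lemma coeff_one_minus_square_power:
  "coeff ([:1, 0, -1 :: rat:] ^ n) k = (if even k then (-1) ^ (k div 2) * of_nat (n choose (k div 2)) else 0)"
proof -
  have "[:1, 0, -1 :: rat:] = monom (-1) 2 + 1"
    by (simp add: monom_altdef numeral_2_eq_2 one_pCons)
  hence "[:1, 0, -1 :: rat:] ^ n = (\<Sum>j\<le>n. of_nat (n choose j) * monom (-1) 2 ^ j * 1 ^ (n - j))"
    by (simp only: binomial_ring)
  also have "\<dots> = (\<Sum>j\<le>n. monom (of_nat (n choose j) * (-1) ^ j) (2 * j))"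
    by (intro sum.cong) (simp_all add: monom_power of_nat_poly smult_monom mult.commute)
  finally have "coeff ([:1, 0, -1 :: rat:] ^ n) k =
      (\<Sum>j\<le>n. if 2 * j = k then of_nat (n choose j) * (-1) ^ j else 0)"
    by (simp add: coeff_sum)
  also have "\<dots> = (\<Sum>j\<le>n. if j = k div 2 then (if even k then of_nat (n choose j) * (-1) ^ j else 0) else 0)"
    by (intro sum.cong) auto
  also have "\<dots> = (if even k then (-1) ^ (k div 2) * of_nat (n choose (k div 2)) else 0)"
    by (auto simp: binomial_eq_0)
  finally show ?thesis .
qed

lemma gbinomial_Suc_mult:
  "of_nat (Suc k) * (a gchoose Suc k) = (a - of_nat k) * (a gchoose k :: 'a :: field_char_0)"
  unfolding left_diff_distrib gbinomial_mult_1 by simp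

text \<open>
  The generalised binomial form is preferable to the central binomial coefficient because it can be
  compared with other binomial coefficients by varying the upper argument modulo \<open>p\<close> or \<open>p^2\<close>.
\<close>

lemma gbinomial_neg_half:
  "(- 1 / 2 :: rat) gchoose m = (-1) ^ m * of_nat ((2 * m) choose m) / 4 ^ m"
proof (induction m)
  case (Suc m)
  have "of_nat (Suc m) * ((- 1 / 2 :: rat) gchoose Suc m) = (- 1 / 2 - of_nat m) * ((- 1 / 2) gchoose m)"
    by (rule gbinomial_Suc_mult)
  moreover have "of_nat (Suc m) * of_nat ((2 * Suc m) choose Suc m) = (2 * (2 * of_nat m + 1) * of_nat ((2 * m) choose m) :: rat)"
  proof -
    have "Suc m * ((2 * Suc m) choose Suc m) = Suc m * (2 * ((2 * m + 1) choose m))"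
    proof -
      have "2 * Suc m = Suc (2 * m + 1)" by simp
      thus ?thesis using Suc_times_binomial_eq[of "2 * m + 1" m] by (metis mult.assoc mult.commute)
    qed
    hence "(2 * Suc m) choose Suc m = 2 * ((2 * m + 1) choose m)"
      using nat_mult_eq_cancel_disj[of "Suc m"] by blast
    also have "(2 * m + 1) choose m = (2 * m + 1) choose (Suc m)"
      using binomial_symmetric[of m "2 * m + 1"] by simp
    finally have "Suc m * ((2 * Suc m) choose Suc m) = 2 * (Suc m * ((2 * m + 1) choose (Suc m)))"
      by (simp only: ac_simps)
    also have "Suc m * ((2 * m + 1) choose (Suc m)) = (2 * m + 1) * ((2 * m) choose m)"
      using Suc_times_binomial_eq[of "2 * m" m] by (simp only: Suc_eq_plus1 ac_simps)
    finally have "Suc m * ((2 * Suc m) choose Suc m) = 2 * (2 * m + 1) * ((2 * m) choose m)"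
      by (simp only: ac_simps)
    hence "(of_nat (Suc m * ((2 * Suc m) choose Suc m)) :: rat) = of_nat (2 * (2 * m + 1) * ((2 * m) choose m))"
      by (simp only:)
    thus ?thesis by (simp only: of_nat_mult of_nat_add of_nat_numeral of_nat_1)
  qed
  moreover have "x * A = x * ((-1) ^ Suc m * B / 4 ^ Suc m)"
    if "x * A = (- 1 / 2 - y) * C" "x * B = 2 * (2 * y + 1) * D" "C = (-1) ^ m * D / 4 ^ m"
    for x y A B C D :: rat
  proof -
    have "x * ((-1) ^ Suc m * B / 4 ^ Suc m) = (-1) ^ Suc m * (x * B) / 4 ^ Suc m" by simp
    also have "\<dots> = (- 1 / 2 - y) * ((-1) ^ m * D / 4 ^ m)"
      unfolding that(2) by (simp add: field_simps)
    finally show ?thesis using that by simp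
  qed
  ultimately have "of_nat (Suc m) * ((- 1 / 2 :: rat) gchoose Suc m) =
      of_nat (Suc m) * ((-1) ^ Suc m * of_nat ((2 * Suc m) choose Suc m) / 4 ^ Suc m)"
    using Suc by blast
  thus ?case by (metis mult_cancel_left of_nat_eq_0_iff nat.distinct(1))
qed auto

lemma legendre_at_zero:
  "(\<Sum>k\<le>n. of_nat (n choose k) * of_nat ((n + k) choose k) * (- 1 / 2 :: rat) ^ k) =
     (if even n then (- 1 / 2) gchoose (n div 2) else 0)"
proof (cases "even n")
  case True
  then obtain b where b: "n = 2 * b" by (elim evenE)
  have "(2 :: rat) ^ (2 * b) = 4 ^ b" by (simp add: power_mult)
  thus ?thesis
    unfolding legendre_at_zero_coeff coeff_one_minus_square_power gbinomial_neg_half b by simp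
next
  case False
  thus ?thesis unfolding legendre_at_zero_coeff coeff_one_minus_square_power by simp
qed

section \<open>Interpolation between two Legendre polynomials\<close>

text \<open>
  For \<open>X = n (n + 1)\<close> this is the Legendre polynomial of degree \<open>n\<close> at the origin, truncated after
  \<open>N\<close> terms. Taking \<open>X\<close> instead of \<open>n\<close> as the variable makes the symmetry between \<open>n\<close> and
  \<open>- 1 - n\<close> visible and gives a polynomial that can be evaluated at arbitrary rational points.
\<close>

definition truncated_legendre :: "nat \<Rightarrow> rat \<Rightarrow> rat" where
  "truncated_legendre N X =
     (\<Sum>k<N. (- 1 / 2) ^ k * (\<Prod>i<k. X - of_nat (i * (i + 1))) / (fact k)\<^sup>2)"

text \<open>
  The Pochhammer form of \<open>(3k)!\<close>: the factors \<open>(3i + 1) (3i + 2)\<close> equal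
  \<open>9 (2/9 + i (i + 1))\<close>, which singles out \<open>X = -2/9\<close>.
\<close>

lemma fact_triple:
  "(fact (3 * k) :: rat) = 27 ^ k * fact k * (\<Prod>i<k. 2 / 9 + of_nat (i * (i + 1)))"
proof (induction k)
  case (Suc k)
  have "3 * Suc k = Suc (Suc (Suc (3 * k)))" by simp
  hence "(fact (3 * Suc k) :: rat) =
      (3 * of_nat k + 3) * (3 * of_nat k + 2) * (3 * of_nat k + 1) * fact (3 * k)"
    by (simp only: fact_Suc of_nat_Suc of_nat_mult of_nat_numeral) (simp add: algebra_simps)
  also have "(3 * of_nat k + 3) * (3 * of_nat k + 2) * (3 * of_nat k + 1) =
      27 * (of_nat k + 1) * (2 / 9 + of_nat k * (of_nat k + 1) :: rat)"
    by (simp add: field_simps)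
  finally show ?case
    unfolding Suc prod.lessThan_Suc fact_Suc power_Suc of_nat_Suc of_nat_mult of_nat_add of_nat_1
    by (simp only: ac_simps)
qed auto

lemma summand_eq:
  "of_nat ((2 * k) choose k) * of_nat ((3 * k) choose k) / 54 ^ k =
     (- 1 / 2) ^ k * (\<Prod>i<k. - 2 / 9 - of_nat (i * (i + 1))) / (fact k :: rat)\<^sup>2"
proof -
  have a: "(of_nat ((2 * k) choose k) :: rat) = fact (2 * k) / (fact k * fact k)"
    using binomial_fact[of k "2 * k", where 'a = rat] by (simp add: mult_2)
  have b: "(of_nat ((3 * k) choose k) :: rat) = fact (3 * k) / (fact k * fact (2 * k))"
    using binomial_fact[of k "3 * k", where 'a = rat] by simp
  have 1: "of_nat ((2 * k) choose k) * of_nat ((3 * k) choose k) / 54 ^ k =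
      (fact (3 * k) :: rat) / (54 ^ k * fact k ^ 3)"
    unfolding a b by (simp add: power3_eq_cube)
  have "(\<Prod>i<k. - 2 / 9 - of_nat (i * (i + 1)) :: rat) =
      (\<Prod>i<k. (-1) * (2 / 9 + of_nat (i * (i + 1))))"
    by (intro prod.cong) auto
  also have "\<dots> = (-1) ^ k * (\<Prod>i<k. 2 / 9 + of_nat (i * (i + 1)))"
    by (simp only: prod.distrib prod_constant card_lessThan)
  finally have 2: "(- 1 / 2) ^ k * (\<Prod>i<k. - 2 / 9 - of_nat (i * (i + 1)) :: rat) =
      ((- 1 / 2) ^ k * (-1) ^ k) * (\<Prod>i<k. 2 / 9 + of_nat (i * (i + 1)))" by simp
  have 3: "(- 1 / 2 :: rat) ^ k * (-1) ^ k = 27 ^ k / 54 ^ k"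
    unfolding power_mult_distrib[symmetric] power_divide[symmetric] by simp
  show ?thesis unfolding 1 2 3 fact_triple
    by (simp add: power3_eq_cube power2_eq_square)
qed

text \<open>
  The factors are \<open>(n - i) (n + 1 + i)\<close>.
\<close>

lemma prod_legendre:
  "(\<Prod>i<k. of_nat (n * (n + 1)) - of_nat (i * (i + 1))) =
     of_nat (n choose k) * of_nat ((n + k) choose k) * (fact k :: rat)\<^sup>2"
proof (induction k)
  case (Suc k)
  have 1: "of_nat (n choose Suc k) * (of_nat (Suc k) :: rat) = of_nat (n choose k) * (of_nat n - of_nat k)"
    unfolding binomial_gbinomial by (simp only: mult.commute gbinomial_Suc_mult)
  have "Suc (n + k) * ((n + k) choose k) = (Suc (n + k) choose Suc k) * Suc k"
    by (rule Suc_times_binomial_eq)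
  hence 2: "of_nat ((n + Suc k) choose Suc k) * (of_nat (Suc k) :: rat) = of_nat (Suc (n + k)) * of_nat ((n + k) choose k)"
    by (metis add_Suc_right of_nat_mult)
  have "of_nat (n choose Suc k) * of_nat ((n + Suc k) choose Suc k) * (fact (Suc k) :: rat)\<^sup>2 =
      (of_nat (n choose Suc k) * of_nat (Suc k)) *
      (of_nat ((n + Suc k) choose Suc k) * of_nat (Suc k)) * (fact k)\<^sup>2"
    by (simp only: fact_Suc power2_eq_square of_nat_fact ac_simps)
  also have "\<dots> = of_nat (n choose k) * of_nat ((n + k) choose k) * (fact k)\<^sup>2 *
      ((of_nat n - of_nat k) * of_nat (Suc (n + k)))"
    unfolding 1 2 by (simp only: ac_simps)
  also have "(of_nat n - of_nat k) * of_nat (Suc (n + k)) =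
      (of_nat (n * (n + 1)) - of_nat (k * (k + 1)) :: rat)"
    by (simp add: algebra_simps)
  finally show ?case using Suc by simp
qed auto

lemma truncated_legendre_at_degree:
  assumes "n < N"
  shows "truncated_legendre N (of_nat (n * (n + 1))) =
     (if even n then (- 1 / 2) gchoose (n div 2) else 0)"
proof -
  have "truncated_legendre N (of_nat (n * (n + 1))) =
     (\<Sum>k<N. of_nat (n choose k) * of_nat ((n + k) choose k) * (- 1 / 2 :: rat) ^ k)"
    unfolding truncated_legendre_def prod_legendre by (intro sum.cong) auto
  also have "\<dots> = (\<Sum>k\<le>n. of_nat (n choose k) * of_nat ((n + k) choose k) * (- 1 / 2 :: rat) ^ k)"
    using assms by (intro sum.mono_neutral_right) auto
  finally show ?thesis by (simp only: legendre_at_zero)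
qed

context prime_modulus
begin

text \<open>
  The functions that look like a polynomial with \<open>p\<close>-integral coefficients in the variable \<open>p Y\<close>, as
  far as this can be seen modulo \<open>p^2\<close>. Unlike a statement about differences of values, this form
  is stable under products.
\<close>

definition affine_mod_square :: "(rat \<Rightarrow> rat) \<Rightarrow> bool" where
  "affine_mod_square f \<longleftrightarrow> (\<exists>a d. p_integral p a \<and> p_integral p d \<and>
     (\<forall>Y. p_integral p Y \<longrightarrow> rat_cong p 2 (f Y) (a + of_nat p * (d * Y))))"

lemma affine_const: "p_integral p c \<Longrightarrow> affine_mod_square (\<lambda>_. c)"
  unfolding affine_mod_square_def by (rule exI[of _ c], rule exI[of _ 0]) auto

lemma affine_id: "p_integral p c \<Longrightarrow> affine_mod_square (\<lambda>Y. c + of_nat p * Y)"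
  unfolding affine_mod_square_def by (rule exI[of _ c], rule exI[of _ 1]) (auto intro!: rat_cong_refl p_integral_add p_integral_mult)

lemma affine_add:
  assumes "affine_mod_square f" "affine_mod_square g"
  shows "affine_mod_square (\<lambda>Y. f Y + g Y)"
proof -
  obtain a d where 1: "p_integral p a" "p_integral p d"
    "\<And>Y. p_integral p Y \<Longrightarrow> rat_cong p 2 (f Y) (a + of_nat p * (d * Y))"
    using assms(1) unfolding affine_mod_square_def by blast
  obtain b e where 2: "p_integral p b" "p_integral p e"
    "\<And>Y. p_integral p Y \<Longrightarrow> rat_cong p 2 (g Y) (b + of_nat p * (e * Y))"
    using assms(2) unfolding affine_mod_square_def by blast
  have "rat_cong p 2 (f Y + g Y) ((a + b) + of_nat p * ((d + e) * Y))" if "p_integral p Y" for Y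
    using rat_cong_add[OF 1(3)[OF that] 2(3)[OF that]] by (simp add: algebra_simps)
  thus ?thesis unfolding affine_mod_square_def using 1 2 by blast
qed

lemma affine_mult:
  assumes "affine_mod_square f" "affine_mod_square g"
  shows "affine_mod_square (\<lambda>Y. f Y * g Y)"
proof -
  obtain a d where 1: "p_integral p a" "p_integral p d"
    "\<And>Y. p_integral p Y \<Longrightarrow> rat_cong p 2 (f Y) (a + of_nat p * (d * Y))"
    using assms(1) unfolding affine_mod_square_def by blast
  obtain b e where 2: "p_integral p b" "p_integral p e"
    "\<And>Y. p_integral p Y \<Longrightarrow> rat_cong p 2 (g Y) (b + of_nat p * (e * Y))"
    using assms(2) unfolding affine_mod_square_def by blast
  have "rat_cong p 2 (f Y * g Y) (a * b + of_nat p * ((a * e + b * d) * Y))" if "p_integral p Y" for Y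
  proof -
    have "rat_cong p 2 (f Y * g Y) ((a + of_nat p * (d * Y)) * (b + of_nat p * (e * Y)))"
      using that by (intro rat_cong_mult 1 2)
    also have "rat_cong p 2 \<dots> (a * b + of_nat p * ((a * e + b * d) * Y))"
    proof (rule rat_congI[of _ "d * Y * e * Y"])
      show "(a + of_nat p * (d * Y)) * (b + of_nat p * (e * Y)) =
          a * b + of_nat p * ((a * e + b * d) * Y) + of_nat (p\<^sup>2) * (d * Y * e * Y)"
        unfolding power2_eq_square of_nat_mult by (simp only: algebra_simps)
    qed (use 1(1,2) 2(1,2) that in \<open>auto intro!: p_integral_add p_integral_mult\<close>)
    finally show ?thesis .
  qed
  moreover have "p_integral p (a * b)" "p_integral p (a * e + b * d)" using 1 2 by auto
  ultimately show ?thesis unfolding affine_mod_square_def by blast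
qed

lemma affine_sum:
  "(\<And>i. i \<in> A \<Longrightarrow> affine_mod_square (f i)) \<Longrightarrow> affine_mod_square (\<lambda>Y. \<Sum>i\<in>A. f i Y)"
  by (induction A rule: infinite_finite_induct) (auto intro: affine_const affine_add)

lemma affine_prod:
  "(\<And>i. i \<in> A \<Longrightarrow> affine_mod_square (f i)) \<Longrightarrow> affine_mod_square (\<lambda>Y. \<Prod>i\<in>A. f i Y)"
  by (induction A rule: infinite_finite_induct) (auto intro: affine_const affine_mult)

text \<open>
  Two values of an affine function determine the third. The coefficients only matter modulo \<open>p\<close>,
  since the slope of the function is a multiple of \<open>p\<close>.
\<close>

lemma affine_interpolation:
  assumes "affine_mod_square f" "p_integral p c" "p_integral p Y1" "p_integral p Y2"
    "rat_cong p 1 (c * Y2) Y1"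
  shows "rat_cong p 2 (c * f Y2) ((c - 1) * f 0 + f Y1)"
proof -
  obtain a d where 1: "p_integral p a" "p_integral p d"
    "\<And>Y. p_integral p Y \<Longrightarrow> rat_cong p 2 (f Y) (a + of_nat p * (d * Y))"
    using assms(1) unfolding affine_mod_square_def by blast
  have "rat_cong p 2 (c * f Y2) (c * (a + of_nat p * (d * Y2)))"
    using assms by (intro rat_cong_scale 1)
  also have "c * (a + of_nat p * (d * Y2)) = c * a + of_nat p * (d * (c * Y2))"
    by (simp add: algebra_simps)
  also have "rat_cong p 2 \<dots> (c * a + of_nat p * (d * Y1))"
    using assms 1 by (intro rat_cong_add rat_cong_p_mult rat_cong_scale) auto
  also have "\<dots> = (c - 1) * (a + of_nat p * (d * 0)) + (a + of_nat p * (d * Y1))"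
    by (simp add: algebra_simps)
  also have "rat_cong p 2 \<dots> ((c - 1) * f 0 + f Y1)"
    using assms by (intro rat_cong_add rat_cong_scale rat_cong_sym[OF 1(3)] p_integral_diff) auto
  finally show ?thesis .
qed

lemma p_integral_half_power:
  assumes "p > 2" shows "p_integral p ((- 1 / 2) ^ k)"
proof -
  have "\<not> p dvd 2" using assms by (auto dest: dvd_imp_le)
  hence "p_integral p (of_int (-1) / of_nat 2)" by (intro p_integral_divide_nat p_integral_of_int)
  thus ?thesis by (intro p_integral_power) simp
qed

lemma affine_truncated_legendre:
  assumes "p > 2" "p_integral p X"
  shows "affine_mod_square (\<lambda>Y. truncated_legendre p (X + of_nat p * Y))"
proof -
  have "affine_mod_square (\<lambda>Y. (- 1 / 2) ^ k / (fact k)\<^sup>2 *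
      (\<Prod>i<k. (X - of_nat (i * (i + 1))) + of_nat p * Y))" if "k < p" for k
    unfolding power2_eq_square divide_divide_eq_left[symmetric] using assms that
    by (intro affine_mult affine_prod affine_id affine_const p_integral_diff p_integral_of_nat
      p_integral_divide_fact p_integral_half_power)
  hence "affine_mod_square (\<lambda>Y. \<Sum>k<p. (- 1 / 2) ^ k / (fact k)\<^sup>2 *
      (\<Prod>i<k. (X - of_nat (i * (i + 1))) + of_nat p * Y))"
    by (intro affine_sum) auto
  thus ?thesis unfolding truncated_legendre_def by (simp add: add_diff_eq diff_add_eq)
qed

text \<open>
  The point \<open>n (n + 1)\<close> with \<open>n = p div 3\<close> serves as the origin. In terms of \<open>p\<close> and \<open>r = p mod 3\<close>,
  the displacements of \<open>(p - 1 - n) (p - n)\<close> and of \<open>-2/9\<close> from it are \<open>p Y1\<close> and \<open>p Y2\<close>. Here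
  \<open>r (r - 3) = -2\<close> makes the constant terms agree for both values of \<open>r\<close>, and \<open>3 Y2 \<equiv> Y1\<close> modulo \<open>p\<close>
  gives the weights \<open>2\<close> and \<open>1\<close>.
\<close>

lemma truncated_sum_interpolation:
  assumes "p > 3" "p = 3 * n + r" "r = 1 \<or> r = 2"
  defines "L \<equiv> (\<lambda>n. if even n then (- 1 / 2 :: rat) gchoose (n div 2) else 0)"
  shows "rat_cong p 2
    (3 * (\<Sum>k = 0..p - 1. of_nat ((2 * k) choose k) * of_nat ((3 * k) choose k) / 54 ^ k))
    (2 * L n + L (p - 1 - n))"
proof -
  define X0 where "X0 = (of_nat (n * (n + 1)) :: rat)"
  define f where "f = (\<lambda>Y. truncated_legendre p (X0 + of_nat p * Y))"
  define Y1 where "Y1 = (of_nat p + 2 * of_nat r - 3 :: rat) / of_nat 3"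
  define Y2 where "Y2 = - (of_nat p + 3 - 2 * of_nat r :: rat) / of_nat 9"
  have nd: "\<not> p dvd 3" "\<not> p dvd 9"
  proof -
    show "\<not> p dvd 3" using assms(1) by (auto dest: dvd_imp_le)
    thus "\<not> p dvd 9" using prime_dvd_mult_iff[OF prime, of 3 3] by simp
  qed
  have n: "(of_nat n :: rat) = (of_nat p - of_nat r) / 3" using assms(2) by simp
  have r: "of_nat r * of_nat r = (3 * of_nat r - 2 :: rat)" using assms(3) by auto
  have int: "p_integral p Y1" "p_integral p Y2" "p_integral p X0"
    unfolding Y1_def Y2_def X0_def minus_divide_left[symmetric]
    by (intro p_integral_divide_nat p_integral_minus p_integral_diff p_integral_add p_integral_mult
          p_integral_of_nat p_integral_numeral nd)+
  have "affine_mod_square f"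
    unfolding f_def using assms(1) int by (intro affine_truncated_legendre) auto
  moreover have "rat_cong p 1 (3 * Y2) Y1"
  proof (rule rat_congI[of _ "- 2 / of_nat 3"])
    show "p_integral p (- 2 / of_nat 3)"
      using p_integral_divide_nat[OF p_integral_of_int[of "-2"] nd(1)] by simp
    show "3 * Y2 = Y1 + of_nat (p ^ 1) * (- 2 / of_nat 3)"
      by (simp add: Y1_def Y2_def field_simps)
  qed (fact int)
  ultimately have "rat_cong p 2 (3 * f Y2) ((3 - 1) * f 0 + f Y1)"
    using int by (intro affine_interpolation) auto
  moreover have "f 0 = L n"
  proof -
    have "n < p" using assms(2,3) by auto
    thus ?thesis unfolding f_def X0_def L_def
      by (simp only: mult_zero_right add_0_right truncated_legendre_at_degree)
  qed
  moreover have "f Y1 = L (p - 1 - n)"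
  proof -
    have n1: "(of_nat (p - 1 - n) :: rat) = of_nat p - 1 - of_nat n"
      using assms(1-3) by (subst of_nat_diff, linarith, subst of_nat_diff) auto
    have "X0 + of_nat p * Y1 = of_nat ((p - 1 - n) * (p - 1 - n + 1))"
      unfolding X0_def Y1_def of_nat_mult of_nat_add n1 n of_nat_1 of_nat_numeral
      using r by (simp add: field_simps)
    thus ?thesis
      unfolding f_def L_def using assms(1) by (simp only: truncated_legendre_at_degree)
  qed
  moreover have "f Y2 = (\<Sum>k = 0..p - 1. of_nat ((2 * k) choose k) * of_nat ((3 * k) choose k) / 54 ^ k)"
  proof -
    have "X0 + of_nat p * Y2 = - 2 / 9"
      unfolding X0_def Y2_def of_nat_mult of_nat_add n of_nat_1 of_nat_numeral
      using r by (simp add: field_simps)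
    moreover have "{..<p} = {0..p - 1}" using assms(1) by auto
    ultimately show ?thesis unfolding f_def truncated_legendre_def summand_eq by simp
  qed
  ultimately show ?thesis by simp
qed

end

section \<open>Binomial coefficients modulo the square of a prime\<close>

context prime_modulus
begin

lemma dvd_choose_prime: "0 < k \<Longrightarrow> k < p \<Longrightarrow> p dvd p choose k"
  using prime by (intro dvd_choose_prime) auto

lemma dvd_choose_multiple:
  assumes "\<not> p dvd k" shows "p dvd (p * n) choose k"
proof -
  obtain j where k: "k = Suc j" using assms by (cases k) auto
  have "Suc j * ((p * n) choose Suc j) = (p * n) * ((p * n - 1) choose j)"
    by (rule binomial_absorption)
  hence "p dvd Suc j * ((p * n) choose Suc j)" by simp
  thus ?thesis using assms prime unfolding k by (metis prime_dvd_mult_iff)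
qed

text \<open>
  One factor \<open>(1 + x)^p\<close> is split off from \<open>(1 + x)^(p (n + 1))\<close>. A term of the Vandermonde sum is
  divisible by \<open>p^2\<close> if neither lower index is a multiple of \<open>p\<close>, which leaves at most three terms.
\<close>

lemma choose_prime_multiple_step:
  fixes i l n :: nat
  assumes "i < p"
  defines "A \<equiv> {..p * l + i} \<inter> {0, i, p}"
  shows "[(p * Suc n) choose (p * l + i) =
    (\<Sum>k\<in>A. (p choose k) * ((p * n) choose (p * l + i - k)))] (mod p\<^sup>2)"
proof -
  let ?T = "\<lambda>k. (p choose k) * ((p * n) choose (p * l + i - k))"
  have "p\<^sup>2 dvd ?T k" if "k \<in> {..p * l + i} - A" for k
  proof (cases "k < p")
    case True
    have k: "k \<le> p * l + i" "k \<noteq> i" "0 < k" using that by (auto simp: A_def)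
    have "\<not> p dvd p * l + i - k"
    proof
      assume "p dvd p * l + i - k"
      hence "[p * l + i = k] (mod p)" using k by (simp add: cong_altdef_nat)
      hence "i mod p = k mod p" by (simp add: cong_def)
      thus False using True assms k by simp
    qed
    thus ?thesis
      using dvd_choose_prime[OF k(3) True] dvd_choose_multiple unfolding power2_eq_square
      by (intro mult_dvd_mono)
  next
    case False
    hence "k > p" using that by (auto simp: A_def)
    thus ?thesis by (simp add: binomial_eq_0)
  qed
  hence "p\<^sup>2 dvd sum ?T ({..p * l + i} - A)" by (rule dvd_sum)
  moreover have "sum ?T {..p * l + i} = sum ?T A + sum ?T ({..p * l + i} - A)"
    by (subst add.commute, rule sum.subset_diff) (auto simp: A_def)
  moreover have "sum ?T {..p * l + i} = (p * Suc n) choose (p * l + i)"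
    using vandermonde[of p "p * n" "p * l + i"] by (simp add: add.commute)
  ultimately show ?thesis by (auto simp: cong_def elim!: dvdE)
qed

lemma choose_prime_multiple_0: "[(p * n) choose (p * l) = n choose l] (mod p\<^sup>2)"
proof (induction n arbitrary: l)
  case (Suc n)
  have p0: "0 < p" using prime by (simp add: prime_gt_0_nat)
  note step = choose_prime_multiple_step[of 0 n l]
  show ?case
  proof (cases l)
    case (Suc l')
    have "{..p * l + 0} \<inter> {0, 0, p} = {0, p}" using Suc by auto
    hence "[(p * Suc n) choose (p * l) = ((p * n) choose (p * l)) + ((p * n) choose (p * l'))] (mod p\<^sup>2)"
      using step p0 Suc by simp
    also have "[((p * n) choose (p * l)) + ((p * n) choose (p * l')) = (n choose l) + (n choose l')] (mod p\<^sup>2)"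
      by (intro cong_add Suc.IH)
    finally show ?thesis by (simp add: Suc add.commute)
  qed simp
next
  case 0
  show ?case using prime by (cases l) (auto simp: prime_gt_0_nat binomial_eq_0)
qed

text \<open>
  Together with the case of lower indices divisible by \<open>p\<close> this says that \<open>(1 + x)^(p n)\<close> is congruent to \<open>(1 + x^p)^n + n R (1 + x^p)^(n - 1)\<close> modulo \<open>p^2\<close>,
  where \<open>R = (1 + x)^p - 1 - x^p\<close> is divisible by \<open>p\<close>.
\<close>

lemma choose_prime_multiple:
  assumes i: "0 < i" "i < p"
  shows "[(p * n) choose (p * l + i) = n * ((n - 1) choose l) * (p choose i)] (mod p\<^sup>2)"
proof (induction n arbitrary: l)
  case (Suc n)
  note step = choose_prime_multiple_step[OF i(2), of n l]
  show ?case
  proof (cases l)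
    case 0
    have "{..p * l + i} \<inter> {0, i, p} = {0, i}" using 0 i by auto
    hence "[(p * Suc n) choose (p * l + i) = ((p * n) choose (p * l + i)) + (p choose i)] (mod p\<^sup>2)"
      using step i 0 by simp
    also have "[((p * n) choose (p * l + i)) + (p choose i) =
       n * ((n - 1) choose l) * (p choose i) + (p choose i)] (mod p\<^sup>2)"
      by (intro cong_add Suc.IH cong_refl)
    finally show ?thesis using 0 by (simp add: add.commute)
  next
    case (Suc l')
    have "{..p * l + i} \<inter> {0, i, p} = {0, i, p}" using Suc i by auto
    hence "[(p * Suc n) choose (p * l + i) = ((p * n) choose (p * l + i)) +
        (p choose i) * ((p * n) choose (p * l)) + ((p * n) choose (p * l' + i))] (mod p\<^sup>2)"
      using step i Suc by (simp add: add.assoc)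
    also have "[((p * n) choose (p * l + i)) +
        (p choose i) * ((p * n) choose (p * l)) + ((p * n) choose (p * l' + i)) =
       n * ((n - 1) choose l) * (p choose i) + (p choose i) * (n choose l) +
       n * ((n - 1) choose l') * (p choose i)] (mod p\<^sup>2)"
      by (intro cong_add cong_mult Suc.IH cong_refl choose_prime_multiple_0)
    also have "n * ((n - 1) choose l) * (p choose i) + (p choose i) * (n choose l) +
       n * ((n - 1) choose l') * (p choose i) = Suc n * ((Suc n - 1) choose l) * (p choose i)"
      unfolding Suc by (cases n) (simp_all add: algebra_simps)
    finally show ?thesis .
  qed
qed (use i in \<open>auto simp: binomial_eq_0\<close>)

text \<open>
  Modulo \<open>p^2\<close> the coefficient on the left factors as
  \<open>(n - 1 choose l) (p n choose a - l)\<close>, because the dependence on \<open>l\<close> in \<open>choose_prime_multiple\<close>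
  is only through \<open>(n - 1 choose l)\<close>. The additional summand is the missing term \<open>l = a\<close> of the Vandermonde
  convolution.
\<close>

lemma choose_prime_multiple_convolution:
  assumes "a < p" "0 < n"
  shows "[(\<Sum>l<a. (p * n) choose (p * l + (a - l))) + ((n - 1) choose a) =
    (p * n + n - 1) choose a] (mod p\<^sup>2)"
proof -
  have "[(\<Sum>l<a. (p * n) choose (p * l + (a - l))) =
      (\<Sum>l<a. ((n - 1) choose l) * ((p * n) choose (a - l)))] (mod p\<^sup>2)"
  proof (rule cong_sum)
    fix l assume "l \<in> {..<a}"
    hence i: "0 < a - l" "a - l < p" using assms by auto
    have "[(p * n) choose (p * l + (a - l)) = n * ((n - 1) choose l) * (p choose (a - l))] (mod p\<^sup>2)"
      by (rule choose_prime_multiple[OF i])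
    also have "n * ((n - 1) choose l) * (p choose (a - l)) =
        ((n - 1) choose l) * (n * ((n - 1) choose 0) * (p choose (a - l)))" by simp
    also have "[\<dots> = ((n - 1) choose l) * ((p * n) choose (p * 0 + (a - l)))] (mod p\<^sup>2)"
      by (intro cong_mult cong_refl cong_sym[OF choose_prime_multiple[OF i]])
    finally show "[(p * n) choose (p * l + (a - l)) = ((n - 1) choose l) * ((p * n) choose (a - l))] (mod p\<^sup>2)"
      by simp
  qed
  hence "[(\<Sum>l<a. (p * n) choose (p * l + (a - l))) + ((n - 1) choose a) =
      (\<Sum>l<a. ((n - 1) choose l) * ((p * n) choose (a - l))) + ((n - 1) choose a)] (mod p\<^sup>2)"
    by (intro cong_add cong_refl)
  also have "(\<Sum>l<a. ((n - 1) choose l) * ((p * n) choose (a - l))) + ((n - 1) choose a) =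
      (\<Sum>l\<le>a. ((n - 1) choose l) * ((p * n) choose (a - l)))"
    by (simp add: lessThan_Suc_atMost[symmetric])
  also have "\<dots> = (p * n + n - 1) choose a"
    using vandermonde[of "n - 1" "p * n" a] assms by (simp add: add.commute)
  finally show ?thesis .
qed

text \<open>
  The lower index \<open>a + (p - 1) l\<close> equals \<open>p l + (a - l)\<close>. The terms before and after \<open>l = a\<close> are
  exchanged by the symmetry of the binomial coefficients together with swapping \<open>a\<close> and \<open>b\<close>, so
  that each half is one convolution sum; the middle term is \<open>(n choose a)\<close> modulo \<open>p^2\<close>, and by Pascal's
  rule it supplies exactly the two summands that complete the convolutions.
\<close>

lemma sum_choose_arithmetic_progression:
  assumes "0 < a" "0 < b" "a + b < p"
  defines "n \<equiv> a + b"
  shows "[(\<Sum>l\<le>n. (p * n) choose (a + (p - 1) * l)) =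
    ((p * n + n - 1) choose a) + ((p * n + n - 1) choose b)] (mod p\<^sup>2)"
proof -
  let ?T = "\<lambda>l. (p * n) choose (a + (p - 1) * l)"
  let ?K = "\<lambda>a. \<Sum>l<a. (p * n) choose (p * l + (a - l))"
  have p1: "0 < p" using assms by simp
  have idx: "a + (p - 1) * l + l = a + p * l" for l
    using p1 by (cases p) auto
  have "{..n} = {..<a} \<union> insert a {a<..n}" by (auto simp: n_def)
  hence "sum ?T {..n} = sum ?T ({..<a} \<union> insert a {a<..n})" by (simp only:)
  also have "\<dots> = sum ?T {..<a} + sum ?T (insert a {a<..n})"
    by (rule sum.union_disjoint) auto
  also have "\<dots> = sum ?T {..<a} + ?T a + sum ?T {a<..n}"
    by (simp add: add.assoc)
  finally have split: "sum ?T {..n} = sum ?T {..<a} + ?T a + sum ?T {a<..n}" .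
  have low: "sum ?T {..<a} = ?K a"
  proof (rule sum.cong)
    fix l assume "l \<in> {..<a}"
    hence "a + (p - 1) * l = p * l + (a - l)" using idx[of l] by simp
    thus "?T l = (p * n) choose (p * l + (a - l))" by simp
  qed simp
  have mid: "?T a = (p * n) choose (p * a)"
  proof -
    have "a + (p - 1) * a = p * a" using idx[of a] by linarith
    thus ?thesis by (simp only:)
  qed
  have high: "sum ?T {a<..n} = ?K b"
  proof (rule sum.reindex_bij_witness[of _ "\<lambda>l. n - l" "\<lambda>l. n - l"])
    fix l assume l: "l \<in> {a<..n}"
    have e: "p * n = p * (n - l) + p * l" using l by (simp add: diff_mult_distrib2)
    have 1: "p * (n - l) + (b - (n - l)) + (a + (p - 1) * l) = p * n"
      unfolding e using idx[of l] l n_def by simp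
    have "(p * n) choose (a + (p - 1) * l) = (p * n) choose (p * n - (a + (p - 1) * l))"
      using 1 by (intro binomial_symmetric) linarith
    also have "p * n - (a + (p - 1) * l) = p * (n - l) + (b - (n - l))"
      using 1 by linarith
    finally show "(p * n) choose (p * (n - l) + (b - (n - l))) = ?T l" ..
  qed (auto simp: n_def)
  have pascal: "n choose a = ((n - 1) choose a) + ((n - 1) choose b)"
  proof -
    have "n choose a = ((n - 1) choose (a - 1)) + ((n - 1) choose a)"
      using assms by (intro choose_reduce_nat) auto
    moreover have "(n - 1) choose (a - 1) = (n - 1) choose b"
      using binomial_symmetric[of b "n - 1"] assms by (simp add: n_def)
    ultimately show ?thesis by simp
  qed
  have "[sum ?T {..n} = ?K a + (n choose a) + ?K b] (mod p\<^sup>2)"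
    unfolding split low mid high by (intro cong_add cong_refl choose_prime_multiple_0)
  moreover have "?K a + (n choose a) + ?K b =
     (?K a + ((n - 1) choose a)) + (?K b + ((n - 1) choose b))"
    unfolding pascal by (simp only: add_ac)
  moreover have "[(?K a + ((n - 1) choose a)) + (?K b + ((n - 1) choose b)) =
      ((p * n + n - 1) choose a) + ((p * n + n - 1) choose b)] (mod p\<^sup>2)"
    using assms by (intro cong_add choose_prime_multiple_convolution) auto
  ultimately show ?thesis by (simp only: cong_def)
qed

end

section \<open>Sums of Legendre symbols\<close>

locale odd_prime_modulus = prime_modulus +
  assumes odd: "p > 2"
begin

abbreviation \<phi> :: "int \<Rightarrow> int" where "\<phi> x \<equiv> Legendre x (int p)"

lemma p_int_pos: "int p > 0" and p_int_prime: "prime (int p)"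
  using prime by (simp_all add: prime_gt_0_nat)

lemma legendre_cong: "[\<phi> a = a ^ ((p - 1) div 2)] (mod int p)"
  by (rule euler_criterion[OF prime odd])

lemma legendre_cases: "\<phi> a = -1 \<or> \<phi> a = 0 \<or> \<phi> a = 1"
  by (simp add: Legendre_def)

lemma legendre_eq_0_iff: "\<phi> a = 0 \<longleftrightarrow> int p dvd a"
  by (simp add: Legendre_def cong_0_iff)

text \<open>
  Elements of \<open>{-1, 0, 1}\<close> that are congruent modulo \<open>p > 2\<close> are equal, so identities for the
  Legendre symbol can be read off from Euler's criterion.
\<close>

lemma legendre_eqI: "[\<phi> a = x] (mod int p) \<Longrightarrow> x \<in> {-1, 0, 1} \<Longrightarrow> \<phi> a = x"
proof -
  assume "[\<phi> a = x] (mod int p)" and x: "x \<in> {-1, 0, 1}"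
  hence d: "int p dvd \<phi> a - x" by (simp add: cong_iff_dvd_diff)
  have "\<bar>\<phi> a\<bar> \<le> 1" "\<bar>x\<bar> \<le> 1" using legendre_cases[of a] x by auto
  hence "\<bar>\<phi> a - x\<bar> < int p" using odd by linarith
  with d have "\<phi> a - x = 0" using dvd_imp_le_int[of "\<phi> a - x" "int p"] by linarith
  thus ?thesis by simp
qed

lemma legendre_periodic: "[a = b] (mod int p) \<Longrightarrow> \<phi> a = \<phi> b"
proof -
  assume "[a = b] (mod int p)"
  hence "[\<phi> a = b ^ ((p - 1) div 2)] (mod int p)"
    using legendre_cong cong_pow cong_trans by blast
  hence "[\<phi> a = \<phi> b] (mod int p)" using legendre_cong cong_sym cong_trans by blast
  thus ?thesis using legendre_cases[of b] by (intro legendre_eqI) auto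
qed

lemma legendre_mult: "\<phi> (a * b) = \<phi> a * \<phi> b"
proof (rule legendre_eqI)
  have "[\<phi> a * \<phi> b = a ^ ((p - 1) div 2) * b ^ ((p - 1) div 2)] (mod int p)"
    by (intro cong_mult legendre_cong)
  thus "[\<phi> (a * b) = \<phi> a * \<phi> b] (mod int p)"
    using legendre_cong[of "a * b"] unfolding power_mult_distrib by (metis cong_sym cong_trans)
  show "\<phi> a * \<phi> b \<in> {-1, 0, 1}" using legendre_cases[of a] legendre_cases[of b] by auto
qed

lemma legendre_1: "\<phi> 1 = 1"
  using legendre_cong[of 1] by (intro legendre_eqI) auto

lemma legendre_power: "\<phi> (a ^ k) = \<phi> a ^ k"
  by (induction k) (simp_all add: legendre_1 legendre_mult)

lemma legendre_square: "\<not> int p dvd a \<Longrightarrow> \<phi> a * \<phi> a = 1"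
  using legendre_cases[of a] legendre_eq_0_iff[of a] by auto

lemma sum_residues_affine:
  fixes f :: "int \<Rightarrow> int"
  assumes periodic: "\<And>x y. [x = y] (mod int p) \<Longrightarrow> f x = f y" and a: "\<not> int p dvd a"
  shows "(\<Sum>x\<in>{0..<int p}. f (a * x + b)) = (\<Sum>x\<in>{0..<int p}. f x)"
proof -
  have "(\<Sum>x\<in>{0..<int p}. f (a * x + b)) = (\<Sum>x\<in>{0..<int p}. f ((a * x + b) mod int p))"
    by (intro sum.cong refl periodic) (simp add: cong_def)
  also have "\<dots> = (\<Sum>x\<in>{0..<int p}. f x)"
  proof (rule sum.reindex_bij_betw)
    have "inj_on (\<lambda>x. (a * x + b) mod int p) {0..<int p}"
    proof (rule inj_onI)
      fix x y assume xy: "x \<in> {0..<int p}" "y \<in> {0..<int p}"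
        "(a * x + b) mod int p = (a * y + b) mod int p"
      hence "int p dvd a * x + b - (a * y + b)" by (simp add: mod_eq_dvd_iff)
      hence "int p dvd a * (x - y)" by (simp add: algebra_simps)
      hence "int p dvd x - y" using a p_int_prime by (simp add: prime_dvd_mult_iff)
      thus "x = y" using xy by (simp add: mod_eq_dvd_iff[symmetric])
    qed
    moreover have "(\<lambda>x. (a * x + b) mod int p) ` {0..<int p} \<subseteq> {0..<int p}"
      using p_int_pos by auto
    ultimately show "bij_betw (\<lambda>x. (a * x + b) mod int p) {0..<int p} {0..<int p}"
      by (simp add: bij_betw_def endo_inj_surj)
  qed
  finally show ?thesis .
qed

lemma residues_split: "{0..<int p} = insert 0 {1..<int p}"
  using p_int_pos by auto

lemma nonzero_residue_coprime: "x \<in> {1..<int p} \<Longrightarrow> coprime x (int p)"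
  and nonzero_residue_not_dvd: "x \<in> {1..<int p} \<Longrightarrow> \<not> int p dvd x"
proof -
  assume "x \<in> {1..<int p}"
  thus nd: "\<not> int p dvd x" using zdvd_not_zless by auto
  thus "coprime x (int p)" using p_int_prime by (metis coprime_commute prime_imp_coprime)
qed

lemma sum_residues_inverse:
  fixes f :: "int \<Rightarrow> int"
  shows "(\<Sum>x\<in>{1..<int p}. f (modular_inverse (int p) x)) = (\<Sum>x\<in>{1..<int p}. f x)"
proof (rule sum.reindex_bij_betw)
  let ?v = "modular_inverse (int p)"
  have sub: "?v ` {1..<int p} \<subseteq> {1..<int p}"
  proof safe
    fix x assume x: "x \<in> {1..<int p}"
    have "?v x > 0" using nonzero_residue_coprime[OF x] odd
      by (intro mult_modular_inverse_int_pos) auto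
    moreover have "?v x < int p" using p_int_pos by (rule modular_inverse_int_less)
    ultimately show "?v x \<in> {1..<int p}" by simp
  qed
  have "inj_on ?v {1..<int p}"
  proof (rule inj_onI)
    fix x y assume xy: "x \<in> {1..<int p}" "y \<in> {1..<int p}" "?v x = ?v y"
    have "[x * ?v x * y = 1 * y] (mod int p)"
      using xy(1) by (intro cong_scalar_right cong_modular_inverse1 nonzero_residue_coprime)
    moreover have "[x * (?v y * y) = x * 1] (mod int p)"
      using xy(2) by (intro cong_scalar_left cong_modular_inverse2 nonzero_residue_coprime)
    ultimately have "[1 * y = x * 1] (mod int p)"
      unfolding xy(3) mult.assoc by (blast intro: cong_sym cong_trans)
    thus "x = y" using xy by (simp add: cong_def)
  qed
  thus "bij_betw ?v {1..<int p} {1..<int p}"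
    using sub by (simp add: bij_betw_def endo_inj_surj)
qed

lemma sum_primroot_powers:
  fixes f :: "int \<Rightarrow> int"
  assumes periodic: "\<And>x y. [x = y] (mod int p) \<Longrightarrow> f x = f y" and g: "residue_primroot p g"
  shows "(\<Sum>i<p - 1. f (int g ^ i)) = (\<Sum>x\<in>{1..<int p}. f x)"
proof -
  have "(\<Sum>i<p - 1. f (int g ^ i)) = (\<Sum>i<p - 1. f (int (g ^ i mod p)))"
    by (intro sum.cong refl periodic) (simp add: cong_def zmod_int)
  also have "\<dots> = (\<Sum>x\<in>totatives p. f (int x))"
    using sum.reindex_bij_betw[OF residue_primroot_is_generator[OF prime_gt_1_nat[OF prime] g], of "\<lambda>x. f (int x)"]
    by (simp add: totient_prime prime)
  also have "totatives p = {0<..<p}"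
    using prime by (rule totatives_prime)
  also have "(\<Sum>x\<in>{0<..<p}. f (int x)) = (\<Sum>x\<in>{1..<int p}. f x)"
    by (rule sum.reindex_bij_witness[of _ nat int]) auto
  finally show ?thesis .
qed

lemma primroot_power_eq_1_iff:
  assumes "residue_primroot p g"
  shows "[int g ^ e = 1] (mod int p) \<longleftrightarrow> (p - 1) dvd e"
proof -
  have "[int g ^ e = 1] (mod int p) \<longleftrightarrow> [g ^ e = 1] (mod p)"
    by (metis cong_int_iff of_nat_1 of_nat_power)
  also have "\<dots> \<longleftrightarrow> (p - 1) dvd e"
    using assms ord_divides[of g e p] by (simp add: residue_primroot_def totient_prime prime)
  finally show ?thesis .
qed

lemma legendre_primroot:
  assumes "residue_primroot p g" shows "\<phi> (int g) = - 1"
proof -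
  have "\<not> (p - 1) dvd (p - 1) div 2" using odd by (auto dest!: dvd_imp_le)
  hence n1: "\<not> [int g ^ ((p - 1) div 2) = 1] (mod int p)"
    using primroot_power_eq_1_iff[OF assms] by simp
  hence "\<phi> (int g) \<noteq> 1" using legendre_cong[of "int g"] by (auto simp: cong_sym_eq)
  moreover have "\<not> int p dvd int g"
  proof
    assume "int p dvd int g"
    hence "[int g ^ (p - 1) = 0 ^ (p - 1)] (mod int p)" by (intro cong_pow) (simp add: cong_0_iff)
    moreover have "[int g ^ (p - 1) = 1] (mod int p)" using primroot_power_eq_1_iff[OF assms] by simp
    ultimately have "[1 = (0 :: int)] (mod int p)"
      using odd by (metis cong_sym cong_trans power_0_left diff_is_0_eq not_le less_trans one_less_numeral_iff semiring_norm(76))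
    thus False using odd by (simp add: cong_0_iff)
  qed
  ultimately show ?thesis using legendre_cases[of "int g"] legendre_eq_0_iff by auto
qed

text \<open>
  Multiplication by a non-residue permutes the residues and changes the sign of the sum.
\<close>

lemma sum_legendre: "(\<Sum>x\<in>{0..<int p}. \<phi> x) = 0"
proof -
  obtain g where g: "residue_primroot p g"
    using prime_primitive_root_exists[of p] prime prime_gt_1_nat by blast
  have "(\<Sum>x\<in>{0..<int p}. \<phi> (int g * x + 0)) = (\<Sum>x\<in>{0..<int p}. \<phi> x)"
    using legendre_primroot[OF g] legendre_eq_0_iff[of "int g"]
    by (intro sum_residues_affine legendre_periodic) auto
  thus ?thesis by (simp add: legendre_mult legendre_primroot[OF g] sum_negf)
qed

lemma sum_legendre_shifted: "(\<Sum>x\<in>{1..<int p}. \<phi> (x + 1)) = - 1"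
proof -
  have "(\<Sum>x\<in>{0..<int p}. \<phi> (1 * x + 1)) = (\<Sum>x\<in>{0..<int p}. \<phi> x)"
    using odd by (intro sum_residues_affine legendre_periodic) auto
  with sum_legendre show ?thesis unfolding residues_split by (simp add: legendre_1)
qed

text \<open>
  Up to a square factor, the product of symbols is that of the quotient
  \<open>(t y + 1) / (y + 1) = t + (1 - t) / (y + 1)\<close>. As \<open>y\<close> varies over the residues other than \<open>-1\<close>,
  this takes every value except \<open>t\<close>, so the sum over all \<open>y\<close> is \<open>- \<phi> t\<close>; the term \<open>y = 0\<close>
  contributes \<open>1\<close>.
\<close>

lemma legendre_autocorrelation:
  assumes "\<not> int p dvd t" "\<not> int p dvd t - 1"
  shows "(\<Sum>y\<in>{1..<int p}. \<phi> (y + 1) * \<phi> (t * y + 1)) = - \<phi> t - 1"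
proof -
  let ?v = "modular_inverse (int p)"
  let ?f = "\<lambda>z. \<phi> z * \<phi> (t * z + (1 - t))"
  have "(\<Sum>y\<in>{0..<int p}. \<phi> (y + 1) * \<phi> (t * y + 1)) = (\<Sum>y\<in>{0..<int p}. ?f (1 * y + 1))"
    by (simp add: algebra_simps)
  also have "\<dots> = (\<Sum>z\<in>{0..<int p}. ?f z)"
  proof (rule sum_residues_affine)
    fix x y :: int assume xy: "[x = y] (mod int p)"
    hence "[t * x + (1 - t) = t * y + (1 - t)] (mod int p)" by (intro cong_add cong_mult cong_refl)
    thus "?f x = ?f y" using xy by (metis legendre_periodic)
  qed (use odd in auto)
  also have "\<dots> = (\<Sum>z\<in>{1..<int p}. ?f z)"
    unfolding residues_split by (simp add: legendre_eq_0_iff)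
  also have "\<dots> = (\<Sum>z\<in>{1..<int p}. \<phi> (t + (1 - t) * ?v z))"
  proof (rule sum.cong[OF refl])
    fix z assume z: "z \<in> {1..<int p}"
    have 1: "[z * ?v z = 1] (mod int p)"
      using nonzero_residue_coprime[OF z] by (rule cong_modular_inverse1)
    have sq: "\<phi> z * \<phi> z = 1" using nonzero_residue_not_dvd[OF z] by (rule legendre_square)
    have "[t * z + (1 - t) * 1 = t * z + (1 - t) * (z * ?v z)] (mod int p)"
      by (intro cong_add cong_mult cong_refl cong_sym[OF 1])
    hence "\<phi> (t * z + (1 - t)) = \<phi> (z * (t + (1 - t) * ?v z))"
      by (intro legendre_periodic) (simp add: algebra_simps)
    thus "?f z = \<phi> (t + (1 - t) * ?v z)"
      using sq by (simp add: legendre_mult mult.assoc[symmetric])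
  qed
  also have "\<dots> = (\<Sum>z\<in>{1..<int p}. \<phi> (t + (1 - t) * z))"
    by (rule sum_residues_inverse)
  also have "\<dots> = (\<Sum>z\<in>{0..<int p}. \<phi> ((1 - t) * z + t)) - \<phi> t"
    unfolding residues_split by (simp add: add.commute)
  also have "(\<Sum>z\<in>{0..<int p}. \<phi> ((1 - t) * z + t)) = (\<Sum>z\<in>{0..<int p}. \<phi> z)"
    using assms(2) by (intro sum_residues_affine legendre_periodic) (auto simp: dvd_diff_commute)
  finally show ?thesis using sum_legendre unfolding residues_split by (simp add: legendre_1)
qed

lemma legendre_autocorrelation_1:
  "(\<Sum>y\<in>{1..<int p}. \<phi> (y + 1) * \<phi> (y + 1)) = int p - 2"
proof -
  have "(\<Sum>y\<in>{1..<int p}. \<phi> (y + 1) * \<phi> (y + 1)) = (\<Sum>y\<in>{1..<int p - 1}. 1)"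
  proof (rule sum.mono_neutral_cong_right)
    show "\<forall>i\<in>{1..<int p} - {1..<int p - 1}. \<phi> (i + 1) * \<phi> (i + 1) = 0"
    proof
      fix i assume "i \<in> {1..<int p} - {1..<int p - 1}"
      hence "i + 1 = int p" by auto
      thus "\<phi> (i + 1) * \<phi> (i + 1) = 0" by (simp add: legendre_eq_0_iff)
    qed
    fix x assume "x \<in> {1..<int p - 1}"
    hence "x + 1 \<in> {1..<int p}" by auto
    thus "\<phi> (x + 1) * \<phi> (x + 1) = 1" by (intro legendre_square nonzero_residue_not_dvd)
  qed auto
  thus ?thesis using odd by simp
qed

end

section \<open>Cubic Jacobi sums\<close>

lemma sum_lessThan_triple:
  fixes f :: "nat \<Rightarrow> 'a :: comm_monoid_add" and q :: nat
  shows "(\<Sum>i<3 * q. f i) = (\<Sum>j<q. f (3 * j)) + (\<Sum>j<q. f (1 + 3 * j)) + (\<Sum>j<q. f (2 + 3 * j))"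
proof (induction q)
  case (Suc q)
  have "3 * Suc q = Suc (Suc (Suc (3 * q)))" by simp
  hence "(\<Sum>i<3 * Suc q. f i) =
      (\<Sum>i<3 * q. f i) + f (3 * q) + f (1 + 3 * q) + f (2 + 3 * q)"
    by (simp only: sum.lessThan_Suc) simp
  thus ?case using Suc by (simp add: add_ac)
qed auto

locale cubic_modulus = odd_prime_modulus +
  fixes q g :: nat
  assumes primroot: "residue_primroot p g" and p_eq: "p = 3 * q + 1" and even_q: "even q"
begin

definition e :: "nat \<Rightarrow> int" where "e i = \<phi> (int g ^ i + 1)"

text \<open>
  The contribution of the cubic class of \<open>g^r\<close> to the sum of \<open>\<phi> (x + 1)\<close> over \<open>x \<noteq> 0\<close>.
\<close>

definition N :: "nat \<Rightarrow> int" where "N r = (\<Sum>j<q. e (r + 3 * j))"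

lemma q_pos: "q > 0"
  using p_eq odd by (cases q) auto

lemma p_minus_1: "p - 1 = 3 * q"
  using p_eq by simp

lemma power_3q: "[int g ^ (3 * q) = 1] (mod int p)"
  using primroot_power_eq_1_iff[OF primroot, of "3 * q"] unfolding p_minus_1 by simp

lemma e_periodic: "e (i + 3 * q) = e i"
proof -
  have "[int g ^ i * int g ^ (3 * q) + 1 = int g ^ i * 1 + 1] (mod int p)"
    by (intro cong_add cong_mult cong_refl power_3q)
  thus ?thesis unfolding e_def power_add by (intro legendre_periodic) simp
qed

lemma N_periodic: "N (r + 3) = N r"
proof -
  have "N r + e (r + 3 * q) = (\<Sum>j<Suc q. e (r + 3 * j))" by (simp add: N_def)
  also have "\<dots> = e r + (\<Sum>j<q. e (r + 3 * Suc j))" by (subst sum.lessThan_Suc_shift) simp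
  also have "(\<Sum>j<q. e (r + 3 * Suc j)) = N (r + 3)"
    unfolding N_def by (intro sum.cong) (simp_all add: algebra_simps)
  finally show ?thesis by (simp add: e_periodic)
qed

lemma N_periodic': "N (r + 3 * j) = N r"
proof (induction j)
  case (Suc j)
  have "r + 3 * Suc j = (r + 3 * j) + 3" by simp
  thus ?case using Suc by (simp only: N_periodic)
qed auto

lemma sum_N: "N 0 + N 1 + N 2 = - 1"
proof -
  have "(\<Sum>i<p - 1. \<phi> (int g ^ i + 1)) = (\<Sum>x\<in>{1..<int p}. \<phi> (x + 1))"
    by (rule sum_primroot_powers[OF _ primroot, of "\<lambda>x. \<phi> (x + 1)"])
      (auto intro!: legendre_periodic cong_add)
  thus ?thesis
    unfolding p_minus_1 e_def[symmetric] sum_lessThan_triple sum_legendre_shifted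
    by (simp add: N_def)
qed

text \<open>
  The autocorrelation of \<open>e\<close> as a function on the cyclic group of order \<open>3 q = p - 1\<close>.
\<close>

definition C :: "nat \<Rightarrow> int" where "C s = (\<Sum>i<3 * q. e i * e (s + i))"

lemma C_eq_sum: "C s = (\<Sum>y\<in>{1..<int p}. \<phi> (y + 1) * \<phi> (int g ^ s * y + 1))"
proof -
  have "(\<Sum>i<p - 1. \<phi> (int g ^ i + 1) * \<phi> (int g ^ s * int g ^ i + 1)) =
      (\<Sum>y\<in>{1..<int p}. \<phi> (y + 1) * \<phi> (int g ^ s * y + 1))"
  proof (rule sum_primroot_powers[OF _ primroot, of "\<lambda>y. \<phi> (y + 1) * \<phi> (int g ^ s * y + 1)"])
    fix x y :: int assume "[x = y] (mod int p)"
    hence "[x + 1 = y + 1] (mod int p)" "[int g ^ s * x + 1 = int g ^ s * y + 1] (mod int p)"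
      by (auto intro!: cong_add cong_mult)
    thus "\<phi> (x + 1) * \<phi> (int g ^ s * x + 1) = \<phi> (y + 1) * \<phi> (int g ^ s * y + 1)"
      by (metis legendre_periodic)
  qed
  thus ?thesis unfolding p_minus_1 by (simp add: C_def e_def power_add)
qed

lemma C_0: "C 0 = int p - 2"
  unfolding C_eq_sum using legendre_autocorrelation_1 by simp

lemma C_pos:
  assumes "0 < s" "s < 3 * q" shows "C s = - ((-1) ^ s) - 1"
proof -
  have "\<not> [int g ^ s = 1] (mod int p)"
    using primroot_power_eq_1_iff[OF primroot, of s] assms unfolding p_minus_1 by (auto dest: dvd_imp_le)
  hence "\<not> int p dvd int g ^ s - 1" by (simp add: cong_iff_dvd_diff)
  moreover have "\<phi> (int g ^ s) = (-1) ^ s"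
    by (simp add: legendre_power legendre_primroot[OF primroot])
  moreover from this have "\<not> int p dvd int g ^ s"
    using legendre_eq_0_iff[of "int g ^ s"] by auto
  ultimately show ?thesis unfolding C_eq_sum by (simp add: legendre_autocorrelation)
qed

lemma sum_C: "(\<Sum>s<q. C (k + 3 * s)) = N 0 * N k + N 1 * N (Suc k) + N 2 * N (Suc (Suc k))"
proof -
  have "(\<Sum>s<q. C (k + 3 * s)) = (\<Sum>i<3 * q. e i * N (k + i))"
    unfolding C_def N_def sum_distrib_left by (subst sum.swap) (simp add: add_ac)
  also have "\<dots> = N 0 * N k + N 1 * N (Suc k) + N 2 * N (Suc (Suc k))"
  proof -
    have "N (k + 3 * j) = N k" "N (k + (1 + 3 * j)) = N (Suc k)"
      "N (k + (2 + 3 * j)) = N (Suc (Suc k))" for j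
      using N_periodic'[of k j] N_periodic'[of "Suc k" j] N_periodic'[of "Suc (Suc k)" j]
      by simp_all
    thus ?thesis unfolding sum_lessThan_triple
      by (simp only: sum_distrib_right[symmetric]) (simp add: N_def)
  qed
  finally show ?thesis .
qed

lemma sum_alternating_even: "even n \<Longrightarrow> (\<Sum>s<n. (-1) ^ s :: int) = 0"
proof (elim evenE)
  fix b assume "n = 2 * b"
  moreover have "(\<Sum>s<2 * b. (-1) ^ s :: int) = 0" by (induction b) auto
  ultimately show ?thesis by simp
qed

text \<open>
  Summing the autocorrelation over shifts divisible by \<open>3\<close> gives the sum of squares, and over shifts
  congruent to \<open>1\<close> the sum of mixed products. All the values of the autocorrelation are known, and
  the alternating signs cancel because \<open>q\<close> is even.
\<close>

lemma norm_N: "N 0 ^ 2 + N 1 ^ 2 + N 2 ^ 2 - (N 0 * N 1 + N 1 * N 2 + N 2 * N 0) = int p"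
proof -
  have "(\<Sum>s<q. C (0 + 3 * s)) = (\<Sum>s<q. (if s = 0 then int p else 0) + (- ((-1) ^ s) - 1))"
  proof (rule sum.cong[OF refl])
    fix s assume "s \<in> {..<q}"
    thus "C (0 + 3 * s) = (if s = 0 then int p else 0) + (- ((-1) ^ s) - 1)"
      using C_0 C_pos[of "3 * s"] by (auto simp: power_mult)
  qed
  also have "\<dots> = int p + (\<Sum>s<q. - ((-1) ^ s) - 1)"
    using q_pos by (simp add: sum.distrib)
  finally have 1: "(\<Sum>s<q. C (0 + 3 * s)) = int p - int q"
    using sum_alternating_even[OF even_q] by (simp add: sum_subtractf sum_negf)
  have "(\<Sum>s<q. C (1 + 3 * s)) = (\<Sum>s<q. (-1) ^ s - 1)"
  proof (rule sum.cong[OF refl])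
    fix s assume "s \<in> {..<q}"
    thus "C (1 + 3 * s) = (-1) ^ s - 1"
      using C_pos[of "1 + 3 * s"] by (auto simp: power_mult power_add)
  qed
  hence 2: "(\<Sum>s<q. C (1 + 3 * s)) = - int q"
    using sum_alternating_even[OF even_q] by (simp add: sum_subtractf)
  have "N 3 = N 0" using N_periodic[of 0] by simp
  thus ?thesis using 1 2 unfolding sum_C
    by (simp add: power2_eq_square numeral_2_eq_2 numeral_3_eq_3 algebra_simps)
qed

text \<open>
  Every summand is odd: \<open>-1\<close> is a cube, so \<open>x + 1 \<noteq> 0\<close> outside the class of cubes. The number of summands
  \<open>q\<close> is even.
\<close>

lemma even_N: "\<not> 3 dvd r \<Longrightarrow> even (N r)"
proof -
  assume r: "\<not> 3 dvd r"
  have "odd (e (r + 3 * j))" for j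
  proof -
    have "\<not> int p dvd int g ^ (r + 3 * j) + 1"
    proof
      assume "int p dvd int g ^ (r + 3 * j) + 1"
      hence "[int g ^ (r + 3 * j) = - 1] (mod int p)" by (simp add: cong_iff_dvd_diff)
      hence "[(int g ^ (r + 3 * j)) ^ q = (- 1) ^ q] (mod int p)" by (rule cong_pow)
      hence "[int g ^ ((r + 3 * j) * q) = 1] (mod int p)" using even_q by (simp add: power_mult)
      hence "3 * q dvd (r + 3 * j) * q" using primroot_power_eq_1_iff[OF primroot] unfolding p_minus_1 by simp
      hence "3 dvd r + 3 * j" using q_pos by simp
      thus False using r by (simp add: dvd_add_left_iff)
    qed
    hence "\<phi> (int g ^ (r + 3 * j) + 1) = -1 \<or> \<phi> (int g ^ (r + 3 * j) + 1) = 1"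
      using legendre_cases legendre_eq_0_iff by blast
    thus ?thesis unfolding e_def by auto
  qed
  thus "even (N r)" unfolding N_def using even_q by (simp add: even_sum_iff)
qed

text \<open>
  The element \<open>N 0 + \<omega> N 1 + \<omega>^2 N 2\<close> of norm \<open>p\<close>, with \<open>\<omega>\<close> a complex cube root of unity, lies in the order generated by the square root of
  \<open>-3\<close> because \<open>N 1\<close> and \<open>N 2\<close> are even. Completing the square gives the representation, and
  \<open>N 0 + N 1 + N 2 = -1\<close> gives the residue of \<open>A\<close> modulo \<open>3\<close>.
\<close>

lemma quadratic_form_N:
  obtains A B :: int where "int p = A\<^sup>2 + 3 * B\<^sup>2" "[A = 1] (mod 3)" "2 * A = - (2 * N 0 - N 1 - N 2)"
proof -
  have e1: "even (N 1)" "even (N 2)" by (intro even_N; simp)+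
  then obtain a b where ab: "N 1 = 2 * a" "N 2 = 2 * b" by (elim evenE)
  define A where "A = a + b - N 0"
  define B where "B = a - b"
  have N0: "N 0 = - 1 - 2 * a - 2 * b" using sum_N ab by simp
  have "int p = A\<^sup>2 + 3 * B\<^sup>2"
    using norm_N unfolding ab A_def B_def by (simp add: power2_eq_square algebra_simps)
  moreover have "A = 1 + 3 * (a + b)" unfolding A_def N0 by simp
  hence "[A = 1] (mod 3)" by (simp add: cong_iff_dvd_diff)
  moreover have "2 * A = - (2 * N 0 - N 1 - N 2)" unfolding A_def ab by simp
  ultimately show ?thesis by (rule that)
qed

end

section \<open>The cubic Jacobi sum modulo the square of the prime\<close>

text \<open>
  The cofactor of \<open>a - b\<close> in \<open>a^p - b^p\<close> is a sum of \<open>p\<close> terms that agree modulo \<open>p\<close>.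
\<close>

lemma (in prime_modulus) cong_power_prime:
  fixes a b :: int
  assumes "[a = b] (mod int p)" shows "[a ^ p = b ^ p] (mod int p ^ 2)"
proof -
  have "[(\<Sum>i<p. b ^ (p - Suc i) * a ^ i) = (\<Sum>i<p. b ^ (p - Suc i) * b ^ i)] (mod int p)"
    by (intro cong_sum cong_mult cong_pow assms cong_refl)
  also have "(\<Sum>i<p. b ^ (p - Suc i) * b ^ i) = (\<Sum>i<p. b ^ (p - 1))"
    by (intro sum.cong) (simp_all add: power_add[symmetric])
  finally have "int p dvd (\<Sum>i<p. b ^ (p - Suc i) * a ^ i)"
    by (simp add: cong_dvd_iff)
  moreover have "int p dvd a - b" using assms by (simp add: cong_iff_dvd_diff)
  ultimately have "int p * int p dvd (a - b) * (\<Sum>i<p. b ^ (p - Suc i) * a ^ i)"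
    by (intro mult_dvd_mono)
  thus ?thesis by (simp add: cong_iff_dvd_diff power_diff_sumr2 power2_eq_square)
qed

lemma (in prime_modulus) geometric_sum_vanishes:
  fixes x :: int
  assumes "[x ^ k = 1] (mod int p ^ 2)" "\<not> [x = 1] (mod int p)"
  shows "[(\<Sum>i<k. x ^ i) = 0] (mod int p ^ 2)"
proof -
  have "int p ^ 2 dvd (x - 1) * (\<Sum>i<k. x ^ i)"
    using assms(1) by (simp add: cong_iff_dvd_diff power_diff_1_eq)
  moreover have "coprime (int p ^ 2) (x - 1)"
    using assms(2) prime by (simp add: cong_iff_dvd_diff prime_imp_coprime coprime_power_left_iff)
  ultimately show ?thesis by (simp add: coprime_dvd_mult_right_iff cong_0_iff)
qed

context cubic_modulus
begin

text \<open>
  The power \<open>g^p\<close> represents the Teichmueller lift of \<open>g\<close> modulo \<open>p^2\<close>: it is congruent to \<open>g\<close> modulo \<open>p\<close>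
  and has order \<open>p - 1\<close> modulo \<open>p^2\<close>.
\<close>

definition teich :: int where "teich = int g ^ p"

text \<open>
  The Jacobi-type sum of the character \<open>g^i \<mapsto> teich^(2 q i)\<close>, which is cubic modulo \<open>p^2\<close>, and the quadratic
  character. Of the two cubic characters this is the one for which the sum is a unit modulo \<open>p\<close>.
\<close>

definition J :: int where "J = (\<Sum>i<3 * q. teich ^ (2 * q * i) * e i)"

lemma teich_power_cong: "[teich ^ i = int g ^ i] (mod int p)"
proof -
  have "[int g ^ (3 * q) * int g = 1 * int g] (mod int p)"
    by (intro cong_mult power_3q cong_refl)
  moreover have "teich = int g ^ (3 * q) * int g"
    unfolding teich_def by (subst p_eq) (simp add: mult.commute)
  ultimately have "[teich = int g] (mod int p)" by simp
  thus ?thesis by (rule cong_pow)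
qed

lemma teich_power_eq_1_iff: "[teich ^ i = 1] (mod int p) \<longleftrightarrow> 3 * q dvd i"
  using primroot_power_eq_1_iff[OF primroot, of i] teich_power_cong[of i] unfolding p_minus_1
  by (blast intro: cong_sym cong_trans)

lemma teich_power_3q: "[teich ^ (3 * q) = 1] (mod int p ^ 2)"
  using cong_power_prime[OF power_3q] by (simp add: teich_def power_mult[symmetric] mult.commute)

lemma teich_power_multiple: "3 * q dvd i \<Longrightarrow> [teich ^ i = 1] (mod int p ^ 2)"
  using cong_pow[OF teich_power_3q] by (auto simp: power_mult elim!: dvdE)

text \<open>
  Orthogonality of the characters of a cyclic group of order \<open>3 q = p - 1\<close>, with values modulo \<open>p^2\<close>.
\<close>

lemma sum_teich_powers:
  "[(\<Sum>i<3 * q. (teich ^ j) ^ i) = (if 3 * q dvd j then int (3 * q) else 0)] (mod int p ^ 2)"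
proof (cases "3 * q dvd j")
  case True
  have "[(\<Sum>i<3 * q. (teich ^ j) ^ i) = (\<Sum>i<3 * q. 1 ^ i)] (mod int p ^ 2)"
    by (intro cong_sum cong_pow teich_power_multiple True)
  thus ?thesis using True by simp
next
  case False
  have "[(\<Sum>i<3 * q. (teich ^ j) ^ i) = 0] (mod int p ^ 2)"
    using False teich_power_multiple[of "j * (3 * q)"] teich_power_eq_1_iff
    by (intro geometric_sum_vanishes) (simp_all add: power_mult)
  thus ?thesis using False by simp
qed

text \<open>
  Raising Euler's criterion to the \<open>p\<close>-th power lifts it to the modulus \<open>p^2\<close>; the left-hand side
  does not change since \<open>p\<close> is odd.
\<close>

lemma cong_legendre_power: "[\<phi> x = x ^ (p * ((p - 1) div 2))] (mod int p ^ 2)"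
proof -
  have "[\<phi> x ^ p = (x ^ ((p - 1) div 2)) ^ p] (mod int p ^ 2)"
    by (intro cong_power_prime legendre_cong)
  moreover have "odd p" using p_eq even_q by simp
  hence "\<phi> x ^ p = \<phi> x" using legendre_cases[of x] odd by auto
  ultimately show ?thesis by (simp add: power_mult[symmetric] mult.commute)
qed

lemma e_cong: "[e i = (teich ^ i + 1) ^ (p * ((p - 1) div 2))] (mod int p ^ 2)"
proof -
  have "e i = \<phi> (teich ^ i + 1)" unfolding e_def
    by (intro legendre_periodic cong_add cong_refl cong_sym[OF teich_power_cong])
  thus ?thesis by (simp only: cong_legendre_power)
qed

text \<open>
  Expand \<open>(teich^i + 1)^(p n)\<close> by the binomial theorem and sum over \<open>i\<close> first. Orthogonality keeps
  the lower indices \<open>j\<close> with \<open>j \<equiv> q\<close> modulo \<open>3 q\<close>; the bound \<open>j \<le> p n\<close> translates into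
  \<open>l \<le> n\<close> because \<open>p n = (p - 1) n + n\<close> and \<open>q \<le> n < q + (p - 1)\<close>.
\<close>

lemma J_cong_sum:
  defines "n \<equiv> (p - 1) div 2"
  shows "[J = int (3 * q) * int (\<Sum>l\<le>n. (p * n) choose (q + (p - 1) * l))] (mod int p ^ 2)"
proof -
  have n2: "2 * n = 3 * q" using even_q unfolding n_def p_minus_1 by simp
  have "[J = (\<Sum>i<3 * q. teich ^ (2 * q * i) * (teich ^ i + 1) ^ (p * n))] (mod int p ^ 2)"
    unfolding J_def n_def by (intro cong_sum cong_mult cong_refl e_cong)
  also have "(\<Sum>i<3 * q. teich ^ (2 * q * i) * (teich ^ i + 1) ^ (p * n)) =
      (\<Sum>i<3 * q. \<Sum>j\<le>p * n. int ((p * n) choose j) * (teich ^ (2 * q + j)) ^ i)"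
    unfolding binomial_ring sum_distrib_left
    by (intro sum.cong refl) (simp add: power_add power_mult power_mult_distrib mult_ac flip: power_mult)
  also have "\<dots> = (\<Sum>j\<le>p * n. int ((p * n) choose j) * (\<Sum>i<3 * q. (teich ^ (2 * q + j)) ^ i))"
    unfolding sum_distrib_left by (rule sum.swap)
  also have "[\<dots> = (\<Sum>j\<le>p * n. int ((p * n) choose j) *
      (if 3 * q dvd 2 * q + j then int (3 * q) else 0))] (mod int p ^ 2)"
    by (intro cong_sum cong_mult cong_refl sum_teich_powers)
  also have "(\<Sum>j\<le>p * n. int ((p * n) choose j) * (if 3 * q dvd 2 * q + j then int (3 * q) else 0)) =
      (\<Sum>j | j \<le> p * n \<and> 3 * q dvd 2 * q + j. int ((p * n) choose j) * int (3 * q))"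
    by (rule sum.mono_neutral_cong_right) auto
  also have "\<dots> = (\<Sum>l\<le>n. int ((p * n) choose (q + (p - 1) * l)) * int (3 * q))"
  proof (rule sum.reindex_bij_witness[of _ "\<lambda>l. q + (p - 1) * l" "\<lambda>j. (j - q) div (3 * q)"])
    fix j assume j: "j \<in> {j. j \<le> p * n \<and> 3 * q dvd 2 * q + j}"
    then obtain c where c: "2 * q + j = 3 * q * c" by (auto elim: dvdE)
    have "c \<noteq> 0" using c q_pos by (cases c) auto
    then obtain l where l: "c = Suc l" by (cases c) auto
    have jl: "j = q + 3 * q * l" using c l by simp
    have "l \<le> n"
    proof (rule ccontr)
      assume "\<not> l \<le> n"
      hence "3 * q * Suc n \<le> 3 * q * l" by (intro mult_le_mono) auto
      moreover have "3 * q * l \<le> p * n" using j jl by simp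
      moreover have "p * n = 3 * q * n + n" unfolding p_eq by simp
      ultimately have "3 * q \<le> n" by simp
      thus False using n2 q_pos by simp
    qed
    have d: "(j - q) div (3 * q) = l" using jl q_pos by simp
    show j_eq: "q + (p - 1) * ((j - q) div (3 * q)) = j"
      by (subst d, subst p_minus_1, rule jl[symmetric])
    show "(j - q) div (3 * q) \<in> {..n}" unfolding d using \<open>l \<le> n\<close> by simp
    show "int ((p * n) choose (q + (p - 1) * ((j - q) div (3 * q)))) * int (3 * q) =
        int ((p * n) choose j) * int (3 * q)" by (simp only: j_eq)
  next
    fix l assume l: "l \<in> {..n}"
    have "2 * q + (q + (p - 1) * l) = 3 * q * Suc l" unfolding p_minus_1 by simp
    hence dv: "3 * q dvd 2 * q + (q + (p - 1) * l)" by (metis dvd_triv_left)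
    have "(p - 1) * l \<le> (p - 1) * n" using l by simp
    moreover have "q \<le> n" using n2 by simp
    moreover have "p * n = (p - 1) * n + n" unfolding p_minus_1 unfolding p_eq by simp
    ultimately have le: "q + (p - 1) * l \<le> p * n" by linarith
    show "(q + (p - 1) * l - q) div (3 * q) = l" unfolding p_minus_1 using q_pos by simp
    show "q + (p - 1) * l \<in> {j. j \<le> p * n \<and> 3 * q dvd 2 * q + j}"
      using dv le by blast
  qed
  also have "\<dots> = int (3 * q) * int (\<Sum>l\<le>n. (p * n) choose (q + (p - 1) * l))"
    by (simp add: sum_distrib_left mult.commute)
  finally show ?thesis .
qed

lemma J_cong_binomials:
  defines "n \<equiv> (p - 1) div 2"
  shows "[J = int (3 * q) * int (((p * n + n - 1) choose q) + ((p * n + n - 1) choose (n - q)))] (mod int p ^ 2)"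
proof -
  have n2: "2 * n = 3 * q" using even_q unfolding n_def p_minus_1 by simp
  have "[(\<Sum>l\<le>q + (n - q). (p * (q + (n - q))) choose (q + (p - 1) * l)) =
    ((p * (q + (n - q)) + (q + (n - q)) - 1) choose q) +
    ((p * (q + (n - q)) + (q + (n - q)) - 1) choose (n - q))] (mod p\<^sup>2)"
    using n2 q_pos p_eq by (intro sum_choose_arithmetic_progression) auto
  moreover have "q + (n - q) = n" using n2 by simp
  ultimately have "[(\<Sum>l\<le>n. (p * n) choose (q + (p - 1) * l)) =
    ((p * n + n - 1) choose q) + ((p * n + n - 1) choose (n - q))] (mod p\<^sup>2)" by (simp only:)
  hence "[int (\<Sum>l\<le>n. (p * n) choose (q + (p - 1) * l)) =
    int (((p * n + n - 1) choose q) + ((p * n + n - 1) choose (n - q)))] (mod int p ^ 2)"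
    by (simp only: cong_int_iff of_nat_power[symmetric])
  thus ?thesis using J_cong_sum[folded n_def] cong_scalar_left cong_trans by blast
qed

text \<open>
  The conjugate \<open>J'\<close> arises by exchanging \<open>z\<close> and \<open>z^2\<close>, where \<open>z\<close> is a cube root of unity with
  \<open>1 + z + z^2 \<equiv> 0\<close>. The sum is the trace form, the product the norm form in the \<open>N r\<close>.
\<close>

lemma J_sum_product:
  obtains J' where "[J + J' = 2 * N 0 - N 1 - N 2] (mod int p ^ 2)"
    "[J * J' = int p] (mod int p ^ 2)"
proof -
  define z where "z = teich ^ (2 * q)"
  have z3: "[z ^ 3 = 1] (mod int p ^ 2)"
    unfolding z_def power_mult[symmetric] by (rule teich_power_multiple) simp
  have "\<not> 3 * q dvd 2 * q" using q_pos by (auto dest: dvd_imp_le)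
  hence "\<not> [z = 1] (mod int p)" unfolding z_def teich_power_eq_1_iff .
  with z3 have "[(\<Sum>i<3. z ^ i) = 0] (mod int p ^ 2)" by (rule geometric_sum_vanishes)
  hence z0: "[1 + z + z ^ 2 = 0] (mod int p ^ 2)" by (simp add: eval_nat_numeral)
  have "[teich ^ (2 * q * (r + 3 * j)) = z ^ r] (mod int p ^ 2)" for r j
  proof -
    have "teich ^ (2 * q * (r + 3 * j)) = z ^ r * teich ^ (3 * q * (2 * j))"
      unfolding z_def power_mult[symmetric] power_add[symmetric] by (simp add: algebra_simps)
    also have "[\<dots> = z ^ r * 1] (mod int p ^ 2)"
      by (intro cong_mult cong_refl teich_power_multiple) simp
    finally show ?thesis by simp
  qed
  hence "[(\<Sum>j<q. teich ^ (2 * q * (r + 3 * j)) * e (r + 3 * j)) = z ^ r * N r] (mod int p ^ 2)" for r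
    unfolding N_def sum_distrib_left by (intro cong_sum cong_mult cong_refl)
  from cong_add[OF cong_add[OF this[of 0] this[of 1]] this[of 2]]
  have J: "[J = N 0 + z * N 1 + z ^ 2 * N 2] (mod int p ^ 2)"
    unfolding J_def sum_lessThan_triple by simp
  define J' where "J' = N 0 + z ^ 2 * N 1 + z * N 2"
  have "[J + J' = (N 0 + z * N 1 + z ^ 2 * N 2) + J'] (mod int p ^ 2)"
    by (intro cong_add J cong_refl)
  also have "(N 0 + z * N 1 + z ^ 2 * N 2) + J' =
      2 * N 0 - N 1 - N 2 + (1 + z + z ^ 2) * (N 1 + N 2)"
    unfolding J'_def by (simp add: algebra_simps)
  also have "[\<dots> = 2 * N 0 - N 1 - N 2 + 0 * (N 1 + N 2)] (mod int p ^ 2)"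
    by (intro cong_add cong_mult cong_refl z0)
  finally have 1: "[J + J' = 2 * N 0 - N 1 - N 2] (mod int p ^ 2)" by simp
  have "[J * J' = (N 0 + z * N 1 + z ^ 2 * N 2) * J'] (mod int p ^ 2)"
    by (intro cong_mult J cong_refl)
  also have "(N 0 + z * N 1 + z ^ 2 * N 2) * J' =
      N 0 ^ 2 + z ^ 3 * N 1 ^ 2 + z ^ 3 * N 2 ^ 2 - (N 0 * N 1 + N 1 * N 2 + N 2 * N 0) +
      (1 + z + z ^ 2) * (N 0 * N 1 + N 2 * N 0) + (1 + z ^ 3 * z + z ^ 2) * (N 1 * N 2)"
    unfolding J'_def by (simp add: algebra_simps power2_eq_square power3_eq_cube)
  also have "[\<dots> = N 0 ^ 2 + 1 * N 1 ^ 2 + 1 * N 2 ^ 2 - (N 0 * N 1 + N 1 * N 2 + N 2 * N 0) +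
      (1 + z + z ^ 2) * (N 0 * N 1 + N 2 * N 0) + (1 + 1 * z + z ^ 2) * (N 1 * N 2)] (mod int p ^ 2)"
    by (intro cong_add cong_diff cong_mult cong_refl z3)
  also have "N 0 ^ 2 + 1 * N 1 ^ 2 + 1 * N 2 ^ 2 - (N 0 * N 1 + N 1 * N 2 + N 2 * N 0) +
      (1 + z + z ^ 2) * (N 0 * N 1 + N 2 * N 0) + (1 + 1 * z + z ^ 2) * (N 1 * N 2) =
      int p + (1 + z + z ^ 2) * (N 0 * N 1 + N 1 * N 2 + N 2 * N 0)"
    unfolding norm_N[symmetric] by (simp add: algebra_simps)
  also have "[\<dots> = int p + 0 * (N 0 * N 1 + N 1 * N 2 + N 2 * N 0)] (mod int p ^ 2)"
    by (intro cong_add cong_mult cong_refl z0)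
  finally have 2: "[J * J' = int p] (mod int p ^ 2)" by simp
  from 1 2 show ?thesis by (rule that)
qed

end

section \<open>The unit root and the supercongruence\<close>

text \<open>
  By Brahmagupta's identity
  \<open>p^2 = (A A' \<plusminus> 3 B B')^2 + 3 (A B' \<mp> A' B)^2\<close>. The prime divides one of \<open>A B' \<mp> A' B\<close>, because their
  product is a multiple of \<open>p\<close>; the identity leaves no room for a nonzero multiple of \<open>p\<close>, so that
  one of them vanishes, and then \<open>A^2 = A'^2\<close>.
\<close>

lemma prime_square_plus_3_square_unique:
  fixes A B A' B' :: int
  assumes "prime p" "p = A\<^sup>2 + 3 * B\<^sup>2" "p = A'\<^sup>2 + 3 * B'\<^sup>2"
  shows "A\<^sup>2 = A'\<^sup>2"
proof -
  have p: "p > 0" using assms(1) by (simp add: prime_gt_0_int)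
  have key: "A\<^sup>2 = A'\<^sup>2"
    if "p dvd A * C - A' * B" "p = A'\<^sup>2 + 3 * C\<^sup>2" for C
  proof -
    obtain k where k: "A * C - A' * B = p * k" using \<open>p dvd A * C - A' * B\<close> by (elim dvdE)
    have "p * p = (A\<^sup>2 + 3 * B\<^sup>2) * (A'\<^sup>2 + 3 * C\<^sup>2)" using assms(2) that(2) by metis
    also have "\<dots> = (A * A' + 3 * B * C)\<^sup>2 + 3 * (A * C - A' * B)\<^sup>2"
      by (simp add: power2_eq_square algebra_simps)
    also have "\<dots> \<ge> 3 * (p * k)\<^sup>2" unfolding k by simp
    finally have "3 * k\<^sup>2 * (p * p) \<le> 1 * (p * p)" by (simp add: power2_eq_square mult_ac)
    hence "3 * k\<^sup>2 \<le> 1" using p by (simp only: mult_le_cancel_right) auto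
    hence "k = 0" using power2_less_eq_zero_iff[of k] by linarith
    hence e: "A * C = A' * B" using k by simp
    have "A\<^sup>2 * p = A\<^sup>2 * A'\<^sup>2 + 3 * (A * C)\<^sup>2" unfolding that(2) by (simp add: power2_eq_square algebra_simps)
    also have "\<dots> = A'\<^sup>2 * (A\<^sup>2 + 3 * B\<^sup>2)" unfolding e by (simp add: power2_eq_square algebra_simps)
    also have "\<dots> = A'\<^sup>2 * p" using assms(2) by simp
    finally show ?thesis using p by simp
  qed
  have "(A * B' - A' * B) * (A * B' - A' * (- B)) = (A\<^sup>2 + 3 * B\<^sup>2) * B'\<^sup>2 - (A'\<^sup>2 + 3 * B'\<^sup>2) * B\<^sup>2"
    by (simp add: power2_eq_square algebra_simps)
  also have "\<dots> = p * (B'\<^sup>2 - B\<^sup>2)"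
    unfolding assms(2)[symmetric] assms(3)[symmetric] by (simp add: algebra_simps)
  finally have "p dvd (A * B' - A' * B) * (A * B' - A' * (- B))" by simp
  hence "p dvd A * B' - A' * B \<or> p dvd A * B' - A' * (- B)"
    using assms(1) by (simp only: prime_dvd_mult_iff)
  moreover have "p dvd A * B' - A' * (- B) \<longleftrightarrow> p dvd A * (- B') - A' * B"
    using dvd_minus_iff[of p "A * B' - A' * (- B)"] by (simp add: algebra_simps)
  ultimately show ?thesis using key[of B'] key[of "- B'"] assms(3) by auto
qed

context prime_modulus
begin

lemma not_dvd_choose: "n < p \<Longrightarrow> k \<le> n \<Longrightarrow> \<not> p dvd n choose k"
proof
  assume "n < p" "k \<le> n" "p dvd n choose k"
  hence "p dvd fact n" using binomial_fact_lemma[of k n] by (metis dvd_mult)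
  thus False using \<open>n < p\<close> not_dvd_fact by blast
qed

lemma p_integral_half: "p > 2 \<Longrightarrow> p_integral p (of_int a / 2)"
proof -
  assume "p > 2"
  hence "\<not> p dvd 2" by (auto dest: dvd_imp_le)
  hence "p_integral p (of_int a / of_nat 2)" by (intro p_integral_divide_nat p_integral_of_int)
  thus ?thesis by simp
qed

lemma rat_cong_cancel_3:
  assumes "p > 3" "rat_cong p n (3 * x) (3 * y)" shows "rat_cong p n x y"
proof -
  have "\<not> int p dvd 3" using assms(1) by (auto dest: zdvd_imp_le)
  thus ?thesis using rat_cong_cancel_int[of 3 n x y] assms(2) by simp
qed

end

lemma gbinomial_neg_three_halves:
  "(- 3 / 2 :: rat) gchoose k = (2 * of_nat k + 1) * ((- 1 / 2) gchoose k)"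
proof -
  have "(- 1 / 2 :: rat) - 1 = - 3 / 2" by simp
  hence "(- 1 / 2 - of_nat k) * ((- 1 / 2 :: rat) gchoose k) = - 1 / 2 * ((- 3 / 2) gchoose k)"
    using gbinomial_absorb_comp[of "- 1 / 2 :: rat" k] by (simp only:)
  thus ?thesis by (simp add: algebra_simps)
qed

context cubic_modulus
begin

text \<open>
  Modulo \<open>p\<close> the upper argument \<open>-1/2\<close> can be replaced by \<open>(p - 1) / 2 = q + q / 2\<close>, and the two lower
  arguments become complementary.
\<close>

lemma central_binomials_cong:
  defines "u \<equiv> (- 1 / 2 :: rat) gchoose (q div 2)" and "v \<equiv> (- 1 / 2 :: rat) gchoose q"
    and "n \<equiv> (p - 1) div 2"
  shows "rat_cong p 1 u (of_nat (n choose q))" and "rat_cong p 1 v (of_nat (n choose q))"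
proof -
  have n: "n = q + q div 2" "2 * n = p - 1" using even_q unfolding n_def p_minus_1 by auto
  have "(of_nat (2 * n) :: rat) = of_nat (p - 1)" using n(2) by simp
  hence n': "(of_nat n :: rat) = (of_nat p - 1) / 2" using odd by (simp add: of_nat_diff)
  have "rat_cong p 1 (of_nat n) (- 1 / 2)"
    by (rule rat_congI[of _ "of_int 1 / 2"])
      (use p_integral_half[OF odd, of 1] p_integral_half[OF odd, of "-1"] in \<open>simp_all add: n' field_simps\<close>)
  hence *: "rat_cong p 1 ((- 1 / 2) gchoose k) (of_nat (n choose k))" if "k < p" for k
    unfolding binomial_gbinomial using that by (intro rat_cong_gbinomial) (auto intro: rat_cong_sym)
  show "rat_cong p 1 v (of_nat (n choose q))" unfolding v_def using p_eq by (intro *) auto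
  have "n choose q = n choose (q div 2)" using n(1) binomial_symmetric[of q n] by simp
  thus "rat_cong p 1 u (of_nat (n choose q))" unfolding u_def using *[of "q div 2"] p_eq by auto
qed

text \<open>
  The upper index \<open>M = p n + n - 1\<close> satisfies \<open>2 (M + 1) = p^2 - 1\<close>, so \<open>M \<equiv> -3/2\<close> modulo \<open>p^2\<close>. Passing
  from \<open>-3/2\<close> to \<open>-1/2\<close> costs the factors \<open>2 q + 1 = (2 p + 1) / 3\<close> and \<open>q + 1 = (p + 2) / 3\<close>.
  Together with the factor \<open>p - 1\<close> the terms of first order in \<open>p\<close> combine to \<open>p (u - v)\<close>, and this
  vanishes modulo \<open>p^2\<close> since \<open>u \<equiv> v\<close> modulo \<open>p\<close>.
\<close>

lemma J_cong_half_binomials: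
  defines "u \<equiv> (- 1 / 2 :: rat) gchoose (q div 2)" and "v \<equiv> (- 1 / 2 :: rat) gchoose q"
  shows "rat_cong p 2 (3 * of_int J) (- (2 * u + v))"
proof -
  define n where "n = (p - 1) div 2"
  define M where "M = p * n + n - 1"
  have n: "n = q + q div 2" "2 * n = p - 1" using even_q unfolding n_def p_minus_1 by auto
  have uv: "rat_cong p 1 u v"
    using central_binomials_cong unfolding u_def v_def by (blast intro: rat_cong_sym rat_cong_trans)
  have "n > 0" using n q_pos by simp
  hence "M + 1 = (p + 1) * n" by (simp add: M_def)
  hence "2 * (M + 1) = (p + 1) * (p - 1)" using n(2) by simp
  hence "(of_nat (2 * (M + 1)) :: rat) = of_nat ((p + 1) * (p - 1))" by (simp only:)
  hence M': "(of_nat M :: rat) = - 3 / 2 + of_nat (p ^ 2) * (1 / 2)"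
    using odd by (simp add: of_nat_diff power2_eq_square field_simps)
  have "rat_cong p 2 (of_nat M) (- 3 / 2)"
    using p_integral_half[OF odd, of 1] p_integral_half[OF odd, of "-3"]
    by (intro rat_congI[OF _ _ M']) simp_all
  hence *: "rat_cong p 2 (of_nat (M choose k)) ((2 * of_nat k + 1) * ((- 1 / 2) gchoose k))"
    if "k < p" for k
    unfolding binomial_gbinomial gbinomial_neg_three_halves[symmetric]
    using that by (intro rat_cong_gbinomial)
  have q': "(of_nat q :: rat) = (of_nat p - 1) / 3" using p_eq by simp
  have m': "(of_nat (q div 2) :: rat) = (of_nat p - 1) / 6"
  proof -
    have "6 * (q div 2) + 1 = p" using p_eq even_q by auto
    hence "(of_nat (6 * (q div 2) + 1) :: rat) = of_nat p" by (simp only:)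
    thus ?thesis by simp
  qed
  have "rat_cong p 2 (of_int J) (of_int (int (3 * q) * int ((M choose q) + (M choose (n - q)))))"
    using J_cong_binomials by (intro rat_cong_of_int) (simp add: M_def n_def)
  also have "of_int (int (3 * q) * int ((M choose q) + (M choose (n - q)))) =
      (of_int (int (3 * q)) :: rat) * (of_nat (M choose q) + of_nat (M choose (q div 2)))"
    using n(1) by simp
  also have "rat_cong p 2 \<dots> (of_int (int (3 * q)) *
      ((2 * of_nat q + 1) * v + (2 * of_nat (q div 2) + 1) * u))"
    unfolding u_def v_def using p_eq
    by (intro rat_cong_scale rat_cong_add * p_integral_of_int) auto
  finally have "rat_cong p 2 (3 * of_int J) (3 * (of_int (int (3 * q)) *
      ((2 * of_nat q + 1) * v + (2 * of_nat (q div 2) + 1) * u)))"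
    by (intro rat_cong_scale) simp_all
  also have "3 * (of_int (int (3 * q)) * ((2 * of_nat q + 1) * v + (2 * of_nat (q div 2) + 1) * u)) =
      - (2 * u + v) + of_nat p * (u - v) + of_nat (p ^ 2) * (u + 2 * v)"
    unfolding m' by (simp add: q' field_simps power2_eq_square)
  also have "rat_cong p 2 \<dots> (- (2 * u + v) + of_nat p * (v - v) + 0)"
  proof (intro rat_cong_add rat_cong_p_mult rat_cong_diff uv rat_cong_refl)
    have int: "p_integral p u" "p_integral p v" using rat_cong_integralD[OF uv] by auto
    show "p_integral p v" by (fact int)
    show "p_integral p (- (2 * u + v))"
      by (intro p_integral_minus p_integral_add p_integral_mult p_integral_numeral int)
    show "rat_cong p 2 (of_nat (p ^ 2) * (u + 2 * v)) 0"
      by (rule rat_congI[of _ "u + 2 * v"])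
        (use int in \<open>simp_all add: p_integral_add p_integral_mult\<close>)
  qed
  finally show ?thesis by simp
qed

text \<open>
  Modulo \<open>p\<close> the previous congruence reads \<open>J \<equiv> - (n choose q)\<close> with \<open>n = (p - 1) / 2\<close>, and this binomial
  coefficient has no factor \<open>p\<close>.
\<close>

lemma not_dvd_J: "\<not> int p dvd J"
proof
  assume "int p dvd J"
  define n where "n = (p - 1) div 2"
  have n: "q \<le> n" "n < p" using even_q odd unfolding n_def p_minus_1 using p_eq by auto
  let ?c = "of_nat (n choose q) :: rat"
  have "[J = 0] (mod int (p ^ 1))" using \<open>int p dvd J\<close> by (simp add: cong_0_iff)
  hence "rat_cong p 1 (3 * of_int J) (3 * of_int 0)"
    by (intro rat_cong_scale rat_cong_of_int) simp_all
  moreover have "rat_cong p 1 (3 * of_int J) (of_int (-1) * (2 * ?c + ?c))"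
  proof -
    have "rat_cong p 1 (3 * of_int J)
      (of_int (-1) * (2 * ((- 1 / 2) gchoose (q div 2)) + ((- 1 / 2) gchoose q)))"
      using rat_cong_mono[OF J_cong_half_binomials] by simp
    also have "rat_cong p 1 \<dots> (of_int (-1) * (2 * ?c + ?c))"
      unfolding n_def
      by (intro rat_cong_scale rat_cong_add central_binomials_cong p_integral_of_int p_integral_numeral)
    finally show ?thesis .
  qed
  ultimately have "rat_cong p 1 (3 * of_int 0) (of_int (-1) * (2 * ?c + ?c))"
    by (blast intro: rat_cong_sym rat_cong_trans)
  hence "rat_cong p 1 (of_int 0) (of_int (- 3 * int (n choose q)))" by simp
  hence "int p dvd 3 * int (n choose q)"
    using cong_of_rat_cong[of 1 0 "- 3 * int (n choose q)"] by (simp add: cong_iff_dvd_diff)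
  hence "p dvd 3 * (n choose q)" by (metis of_nat_dvd_iff of_nat_mult of_nat_numeral)
  moreover have "\<not> p dvd 3" using p_eq q_pos by (auto dest!: dvd_imp_le)
  ultimately show False using not_dvd_choose[OF n(2,1)] prime by (simp add: prime_dvd_mult_iff)
qed

text \<open>
  Since \<open>J\<close> is a unit and \<open>J J' \<equiv> p\<close>, the conjugate \<open>J'\<close> is divisible by \<open>p\<close>, whence
  \<open>J'^2 \<equiv> 0\<close> modulo \<open>p^2\<close>. With \<open>2 A \<equiv> - (J + J')\<close> this gives
  \<open>-2 A J \<equiv> (J + J')^2 - J J' - J'^2 \<equiv> 4 A^2 - p\<close>, and \<open>2 A \<equiv> - J\<close> modulo \<open>p\<close> can be cancelled.
\<close>

lemma unit_root_expansion:
  assumes "2 * A = - (2 * N 0 - N 1 - N 2)"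
  shows "\<not> int p dvd 2 * A" "rat_cong p 2 (- of_int J) (2 * of_int A - of_nat p / (2 * of_int A))"
proof -
  obtain J' where sum: "[J + J' = 2 * N 0 - N 1 - N 2] (mod int p ^ 2)"
    and prod: "[J * J' = int p] (mod int p ^ 2)" by (rule J_sum_product)
  have sum: "[J + J' = - (2 * A)] (mod int p ^ 2)" using sum assms by simp
  have "int p dvd int p ^ 2" by simp
  have "[J * J' = 0] (mod int p)"
    using cong_dvd_modulus[OF prod \<open>int p dvd int p ^ 2\<close>] by (simp add: cong_def)
  hence "int p dvd J'" using not_dvd_J p_int_prime by (simp add: cong_0_iff prime_dvd_mult_iff)
  hence sq: "[J' * J' = 0] (mod int p ^ 2)"
    unfolding cong_0_iff power2_eq_square by (intro mult_dvd_mono)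
  show nd: "\<not> int p dvd 2 * A"
  proof
    assume "int p dvd 2 * A"
    hence "int p dvd J + J'"
      using cong_dvd_iff[OF cong_dvd_modulus[OF sum \<open>int p dvd int p ^ 2\<close>]] by simp
    thus False using \<open>int p dvd J'\<close> not_dvd_J by (simp add: dvd_add_left_iff)
  qed
  have "[- (2 * A) * J = (J + J') * J] (mod int p ^ 2)"
    by (intro cong_mult cong_refl cong_sym[OF sum])
  also have "(J + J') * J = (J + J') * (J + J') - J * J' - J' * J'" by (simp add: algebra_simps)
  also have "[\<dots> = - (2 * A) * - (2 * A) - int p - 0] (mod int p ^ 2)"
    by (intro cong_diff cong_mult sum prod sq)
  finally have "rat_cong p 2 (of_int (- (2 * A) * J)) (of_int (4 * A\<^sup>2 - int p))"
    by (intro rat_cong_of_int) (simp add: power2_eq_square)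
  moreover have "A \<noteq> 0" using nd by auto
  hence "of_int (4 * A\<^sup>2 - int p) = of_int (2 * A) * (2 * of_int A - of_nat p / (2 * of_int A) :: rat)"
    by (simp add: field_simps power2_eq_square)
  moreover have "of_int (- (2 * A) * J) = of_int (2 * A) * (- of_int J :: rat)" by simp
  ultimately show "rat_cong p 2 (- of_int J) (2 * of_int A - of_nat p / (2 * of_int A))"
    using rat_cong_cancel_int[OF nd, of 2 "- of_int J"] by (simp only:)
qed

lemma truncated_sum_cong_J:
  "rat_cong p 2 (\<Sum>k = 0..p - 1. of_nat ((2 * k) choose k) * of_nat ((3 * k) choose k) / 54 ^ k)
     (- of_int J)" (is "rat_cong p 2 ?S _")
proof (rule rat_cong_cancel_3)
  show p3: "p > 3" using p_eq q_pos by simp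
  define u where "u = (- 1 / 2 :: rat) gchoose (q div 2)"
  define v where "v = (- 1 / 2 :: rat) gchoose q"
  have "p - 1 - q = 2 * q" using p_eq by simp
  hence "rat_cong p 2 (3 * ?S) (2 * u + v)"
    using truncated_sum_interpolation[OF p3 p_eq] even_q by (simp add: u_def v_def)
  also have "2 * u + v = of_int (-1) * (- (2 * u + v))" by simp
  also have "rat_cong p 2 \<dots> (of_int (-1) * (3 * of_int J))"
    unfolding u_def v_def
    by (rule rat_cong_scale[OF p_integral_of_int rat_cong_sym[OF J_cong_half_binomials]])
  finally show "rat_cong p 2 (3 * ?S) (3 * (- of_int J))" by simp
qed

end

theorem theorem3p4:
  fixes p :: nat
  assumes "prime p" and "p > 3"
  shows "([p = 1] (mod 3) \<longrightarrow>
           (\<forall>A B :: int. int p = A ^ 2 + 3 * B ^ 2 \<and> [A = 1] (mod 3) \<longrightarrow>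
              rat_cong p 2
                (\<Sum>k = 0..p - 1. of_nat ((2 * k) choose k) * of_nat ((3 * k) choose k) / 54 ^ k)
                (2 * of_int A - of_nat p / (2 * of_int A)))) \<and>
         ([p = 2] (mod 3) \<longrightarrow>
              rat_cong p 2
                (\<Sum>k = 0..p - 1. of_nat ((2 * k) choose k) * of_nat ((3 * k) choose k) / 54 ^ k)
                0)" (is "(_ \<longrightarrow> (\<forall>A B. _ A B \<longrightarrow> rat_cong p 2 ?S (?R A))) \<and> _")
proof (intro conjI impI allI)
  interpret odd_prime_modulus p using assms by unfold_locales auto
  have odd_p: "odd p" using assms by (simp add: prime_odd_nat)
  {
    fix A B :: int
    assume p1: "[p = 1] (mod 3)" and AB: "int p = A ^ 2 + 3 * B ^ 2 \<and> [A = 1] (mod 3)"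
    define q where "q = p div 3"
    have p_eq: "p = 3 * q + 1"
      using p1 mult_div_mod_eq[of 3 p] by (simp add: q_def cong_def)
    have "even q" using odd_p unfolding p_eq by simp
    obtain g where "residue_primroot p g"
      using prime_primitive_root_exists[of p] assms prime_gt_1_nat by blast
    then interpret cubic_modulus p q g using p_eq \<open>even q\<close> by unfold_locales
    obtain A' B' where A': "int p = A'\<^sup>2 + 3 * B'\<^sup>2" "[A' = 1] (mod 3)"
      "2 * A' = - (2 * N 0 - N 1 - N 2)" by (rule quadratic_form_N)
    have "A\<^sup>2 = A'\<^sup>2"
      using prime_square_plus_3_square_unique[OF p_int_prime _ A'(1)] AB by blast
    hence "A = A' \<or> A = - A'" by (simp add: power2_eq_iff)
    moreover have "A \<noteq> - A'"
    proof
      assume "A = - A'"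
      hence "[A + A' = 1 + 1] (mod 3)" using AB A'(2) by (intro cong_add) auto
      thus False using \<open>A = - A'\<close> by (simp add: cong_def)
    qed
    ultimately have "A = A'" by blast
    hence "rat_cong p 2 (- of_int J) (?R A)" using unit_root_expansion(2)[OF A'(3)] by simp
    with truncated_sum_cong_J show "rat_cong p 2 ?S (?R A)" by (rule rat_cong_trans)
  next
    assume p2: "[p = 2] (mod 3)"
    define n where "n = p div 3"
    have p_eq: "p = 3 * n + 2"
      using p2 mult_div_mod_eq[of 3 p] by (simp add: n_def cong_def)
    have "odd n" using odd_p unfolding p_eq by simp
    moreover have "p - 1 - n = 2 * n + 1" using p_eq by simp
    ultimately have "rat_cong p 2 (3 * ?S) (3 * 0)"
      using truncated_sum_interpolation[OF assms(2) p_eq] by simp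
    thus "rat_cong p 2 ?S 0" by (rule rat_cong_cancel_3[OF assms(2)])
  }
qed

end
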